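(* Let $(x_i)$ and $(y_i)$ be the sequences of positive real numbers constructed in the context. Then the conditionally convergent series $\sum_{i=1}^\infty v_i$ in $\mathbb{R}^2$ with $v_i=((-1)^ix_i,(-1)^iy_i)$ satisfies $\mathrm{SR}(v_i)=\mathbb{R}^2$, has exactly two Levy vectors, and each vertical section of its achievement set has at most one element, that is, for every $a\in\mathbb{R}$ the set $\{b\in\mathbb{R}:(a,b)\in\mathrm{A}(v_i)\}$ has at most one element.
   Context: Construction. Define natural numbers $0=N_0<N_1<N_2<\dots$, positive reals $\delta_k$ ($k\ge1$) and positive reals $x_i$ ($i\ge1$) inductively. Put $N_1=1$, $x_1=1$, $\delta_1=1$. Given $N_k$, $\delta_k$ and $x_i$ for $i\le N_k$ (where $k\ge1$), let $n$ be the natural number with $\frac{2^n\delta_k}{4^{k+3}}=1$, put $N_{k+1}=N_k+2^n$, put $x_{N_k+i}=\frac{\delta_k}{2\cdot4^{k+1}}+\frac{1}{2^{2^n+i}}$ for $i=1,\dots,2^n$, and put $\delta_{k+1}=\min\{|\sum_{i=N_k+1}^{N_{k+1}}\xi_ix_i|:\xi_i\in\{-1,0,1\},\ \xi_i\ne0\text{ for some }i\}=\frac{1}{4^{2^n}}$. Finally put $y_i=\frac{1}{2^k}$ for $i\in(N_k,N_{k+1}]$, $k\ge0$. Definitions. A series in $\mathbb{R}^2$ is conditionally convergent if it converges but the series of norms of its terms diverges. $\mathrm{SR}(v_i)$ is the set of sums of all convergent rearrangements $\sum_{i=1}^\infty v_{\sigma(i)}$, $\sigma$ a permutation of $\mathbb{N}$.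 $\mathrm{A}(v_i)$ is the set of sums $\sum_{i=1}^\infty\varepsilon_iv_i$ over all $(\varepsilon_i)\in\{0,1\}^{\mathbb{N}}$ for which this series converges. A vector $u\in\mathbb{R}^2$ with $\Vert u\Vert=1$ is a Levy vector of $\sum v_i$ if for every $\varepsilon>0$ we have $\sum_{i:\,v_i\in S_\varepsilon(u)}\Vert v_i\Vert=\infty$, where $S_\varepsilon(u)=\{v\in\mathbb{R}^2:\langle u,v\rangle\ge(1-\varepsilon)\Vert u\Vert\,\Vert v\Vert\}$. *)

theory Defs
  imports "HOL-Analysis.Analysis"
begin

section \<open>The construction\<close>

definition min_signed_sum :: "nat set \<Rightarrow> (nat \<Rightarrow> real) \<Rightarrow> real" where
  "min_signed_sum I x =
     Min {\<bar>\<Sum>i\<in>I. of_int (\<xi> i) * x i\<bar> | \<xi> :: nat \<Rightarrow> int.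
            (\<forall>i\<in>I. \<xi> i \<in> {-1, 0, 1}) \<and> (\<exists>i\<in>I. \<xi> i \<noteq> 0)}"

definition block_exp :: "nat \<Rightarrow> real \<Rightarrow> nat" where
  "block_exp k d = (THE n. 2 ^ n * d / 4 ^ (k + 3) = 1)"

definition block_term :: "nat \<Rightarrow> real \<Rightarrow> nat \<Rightarrow> real" where
  "block_term k d i = d / (2 * 4 ^ (k + 1)) + 1 / 2 ^ (2 ^ block_exp k d + i)"

text \<open>
  The sequence \<open>\<delta>\<close> of the construction starts at index 1; the value at index 0 is a dummy.
  The indices of the new block are shifted to \<open>1, \<dots>, 2\<^sup>n\<close> here, so that \<open>\<delta>\<close> can be defined
  before the sequence \<open>x\<close>. The lemma \<open>construction\<close> below restates the recursion in terms
  of the \<open>N\<^sub>k\<close> and \<open>x\<^sub>i\<close> themselves.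
\<close>

primrec delta :: "nat \<Rightarrow> real" where
  "delta 0 = 1"
| "delta (Suc k) =
     (if k = 0 then 1
      else min_signed_sum {1..2 ^ block_exp k (delta k)} (block_term k (delta k)))"

primrec block_end :: "nat \<Rightarrow> nat" where
  "block_end 0 = 0"
| "block_end (Suc k) = (if k = 0 then 1 else block_end k + 2 ^ block_exp k (delta k))"

definition block_of :: "nat \<Rightarrow> nat" where
  "block_of i = (THE k. i \<in> {block_end k<..block_end (Suc k)})"

text \<open>The sequences \<open>x\<close> and \<open>y\<close> are only meaningful for indices at least 1.\<close>

definition xseq :: "nat \<Rightarrow> real" where
  "xseq i = (let k = block_of i
             in if k = 0 then 1 else block_term k (delta k) (i - block_end k))"

definition yseq :: "nat \<Rightarrow> real" where
  "yseq i = 1 / 2 ^ block_of i"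


section \<open>Series\<close>

definition conditionally_convergent :: "(nat \<Rightarrow> 'a::real_normed_vector) \<Rightarrow> bool" where
  "conditionally_convergent v \<longleftrightarrow> summable v \<and> \<not> summable (\<lambda>i. norm (v i))"

definition sum_range :: "(nat \<Rightarrow> 'a::real_normed_vector) \<Rightarrow> 'a set" where
  "sum_range v = {s. \<exists>\<sigma>. bij \<sigma> \<and> (\<lambda>i. v (\<sigma> i)) sums s}"

definition achievement_set :: "(nat \<Rightarrow> 'a::real_normed_vector) \<Rightarrow> 'a set" where
  "achievement_set v =
     {s. \<exists>\<epsilon> :: nat \<Rightarrow> real. (\<forall>i. \<epsilon> i \<in> {0, 1}) \<and> (\<lambda>i. \<epsilon> i *\<^sub>R v i) sums s}"

definition levy_cone :: "real \<Rightarrow> 'a::real_inner \<Rightarrow> 'a set" where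
  "levy_cone e u = {w. inner u w \<ge> (1 - e) * norm u * norm w}"

text \<open>The summands are nonnegative, so the sum is infinite iff they are not summable.\<close>

definition levy_vector :: "(nat \<Rightarrow> 'a::real_inner) \<Rightarrow> 'a \<Rightarrow> bool" where
  "levy_vector v u \<longleftrightarrow>
     norm u = 1 \<and> (\<forall>e>0. \<not> (\<lambda>i. norm (v i)) summable_on {i. v i \<in> levy_cone e u})"

definition vertical_section :: "('a \<times> 'b) set \<Rightarrow> 'a \<Rightarrow> 'b set" where
  "vertical_section A a = {b. (a, b) \<in> A}"


section \<open>The construction is well defined\<close>

lemma signed_binary_eq_0:
  fixes \<xi> :: "nat \<Rightarrow> int"
  assumes "\<forall>i\<in>{1..m}. \<xi> i \<in> {-1, 0, 1}" "(\<Sum>i=1..m. \<xi> i * 2 ^ (m - i)) = 0"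
  shows "\<forall>i\<in>{1..m}. \<xi> i = 0"
  using assms
proof (induction m)
  case 0
  then show ?case by simp
next
  case (Suc m)
  have "(\<Sum>i=1..m. \<xi> i * 2 ^ (Suc m - i)) = 2 * (\<Sum>i=1..m. \<xi> i * 2 ^ (m - i))"
    unfolding sum_distrib_left by (intro sum.cong) (auto simp: Suc_diff_le)
  then have eq: "2 * (\<Sum>i=1..m. \<xi> i * 2 ^ (m - i)) + \<xi> (Suc m) = 0"
    using Suc.prems(2) by simp
  have last: "\<xi> (Suc m) \<in> {-1, 0, 1}" using Suc.prems(1) by simp
  have "\<xi> (Suc m) = 0" using eq last by auto presburger+
  moreover have "(\<Sum>i=1..m. \<xi> i * 2 ^ (m - i)) = 0" using eq calculation by simp
  then have "\<forall>i\<in>{1..m}. \<xi> i = 0" using Suc.prems(1) by (intro Suc.IH) simp_all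
  ultimately show ?case by (auto simp: le_Suc_eq)
qed

lemma finite_signed_sums:
  assumes "finite I"
  shows "finite {\<bar>\<Sum>i\<in>I. of_int (\<xi> i) * (x i :: real)\<bar> | \<xi> :: nat \<Rightarrow> int.
            (\<forall>i\<in>I. \<xi> i \<in> {-1, 0, 1}) \<and> (\<exists>i\<in>I. \<xi> i \<noteq> 0)}" (is "finite ?S")
proof (rule finite_subset)
  show "?S \<subseteq> (\<lambda>\<xi>. \<bar>\<Sum>i\<in>I. of_int (\<xi> i) * x i\<bar>) ` (I \<rightarrow>\<^sub>E {-1, 0, 1})"
  proof
    fix s assume "s \<in> ?S"
    then obtain \<xi> where \<xi>: "s = \<bar>\<Sum>i\<in>I. of_int (\<xi> i) * x i\<bar>" "\<forall>i\<in>I. \<xi> i \<in> {-1, 0, 1::int}"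
      by blast
    have "s = \<bar>\<Sum>i\<in>I. of_int (restrict \<xi> I i) * x i\<bar>"
      unfolding \<xi>(1) by (intro arg_cong[of _ _ abs] sum.cong) auto
    moreover have "restrict \<xi> I \<in> I \<rightarrow>\<^sub>E {-1, 0, 1}" using \<xi>(2) by auto
    ultimately show "s \<in> (\<lambda>\<xi>. \<bar>\<Sum>i\<in>I. of_int (\<xi> i) * x i\<bar>) ` (I \<rightarrow>\<^sub>E {-1, 0, 1})" by blast
  qed
  show "finite ((\<lambda>\<xi>. \<bar>\<Sum>i\<in>I. of_int (\<xi> i) * x i\<bar>) ` (I \<rightarrow>\<^sub>E {-1, 0, 1::int}))"
    using assms by (intro finite_imageI finite_PiE) auto
qed

lemma min_signed_sum_block:
  fixes c :: real
  assumes m: "m \<ge> 2" and c: "c \<ge> 1 / 2 ^ m"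
  shows "min_signed_sum {1..m} (\<lambda>i. c + 1 / 2 ^ (m + i)) = 1 / 4 ^ m"
proof -
  let ?x = "\<lambda>i. c + 1 / 2 ^ (m + i)"
  have val: "(\<Sum>i=1..m. of_int (\<xi> i) * ?x i) =
      of_int (\<Sum>i=1..m. \<xi> i) * c + of_int (\<Sum>i=1..m. \<xi> i * 2 ^ (m - i)) / 4 ^ m"
    for \<xi> :: "nat \<Rightarrow> int"
  proof -
    have "1 / 2 ^ (m + i) = (2 ^ (m - i) / 4 ^ m :: real)" if "i \<in> {1..m}" for i
    proof -
      have "(4::real) ^ m = 2 ^ (m + i) * 2 ^ (m - i)"
      proof -
        have "(2::real) ^ (m + i) * 2 ^ (m - i) = 2 ^ (2 * m)"
          using that by (simp flip: power_add)
        then show ?thesis by (simp add: power_mult)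
      qed
      then show ?thesis by (simp add: field_simps)
    qed
    then have "(\<Sum>i=1..m. of_int (\<xi> i) * ?x i) =
        (\<Sum>i=1..m. of_int (\<xi> i) * c + of_int (\<xi> i * 2 ^ (m - i)) / 4 ^ m)"
      by (intro sum.cong) (simp_all add: algebra_simps)
    also have "\<dots> = of_int (\<Sum>i=1..m. \<xi> i) * c + of_int (\<Sum>i=1..m. \<xi> i * 2 ^ (m - i)) / 4 ^ m"
      by (simp add: sum.distrib sum_distrib_right sum_divide_distrib)
    finally show ?thesis .
  qed
  have geo: "(\<Sum>i=1..m. (2::int) ^ (m - i)) = 2 ^ m - 1"
  proof -
    have "(\<Sum>i=1..m. (2::int) ^ (m - i)) = (\<Sum>i<m. 2 ^ i)"
      by (rule sum.reindex_bij_witness[of _ "\<lambda>i. m - i" "\<lambda>i. m - i"]) auto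
    then show ?thesis using power_diff_1_eq[of "2::int" m] by simp
  qed
  show ?thesis
    unfolding min_signed_sum_def
  proof (rule Min_eqI)
    show "finite {\<bar>\<Sum>i\<in>{1..m}. of_int (\<xi> i) * ?x i\<bar> | \<xi> :: nat \<Rightarrow> int.
            (\<forall>i\<in>{1..m}. \<xi> i \<in> {-1, 0, 1}) \<and> (\<exists>i\<in>{1..m}. \<xi> i \<noteq> 0)}"
      by (rule finite_signed_sums) simp
  next
    fix s assume "s \<in> {\<bar>\<Sum>i\<in>{1..m}. of_int (\<xi> i) * ?x i\<bar> | \<xi> :: nat \<Rightarrow> int.
            (\<forall>i\<in>{1..m}. \<xi> i \<in> {-1, 0, 1}) \<and> (\<exists>i\<in>{1..m}. \<xi> i \<noteq> 0)}"
    then obtain \<xi> :: "nat \<Rightarrow> int" where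
      s: "s = \<bar>\<Sum>i\<in>{1..m}. of_int (\<xi> i) * ?x i\<bar>"
      and \<xi>: "\<forall>i\<in>{1..m}. \<xi> i \<in> {-1, 0, 1}" "\<exists>i\<in>{1..m}. \<xi> i \<noteq> 0" by blast
    define T where "T = (\<Sum>i=1..m. \<xi> i * 2 ^ (m - i))"
    define S where "S = (\<Sum>i=1..m. \<xi> i)"
    have T0: "\<bar>T\<bar> \<ge> 1" using signed_binary_eq_0[OF \<xi>(1)] \<xi>(2) unfolding T_def by force
    have s': "s = \<bar>of_int S * c + of_int T / 4 ^ m\<bar>" unfolding s val S_def T_def ..
    show "1 / 4 ^ m \<le> s"
    proof (cases "S = 0")
      case True
      then show ?thesis using T0 by (simp add: s' divide_simps)
    next
      case False
      have "\<bar>T\<bar> \<le> (\<Sum>i=1..m. \<bar>\<xi> i * 2 ^ (m - i)\<bar>)" unfolding T_def by (rule sum_abs)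
      also have "\<dots> \<le> (\<Sum>i=1..m. 2 ^ (m - i))"
      proof (rule sum_mono)
        fix i assume "i \<in> {1..m}"
        then have "\<xi> i \<in> {-1, 0, 1}" using \<xi>(1) by blast
        then show "\<bar>\<xi> i * 2 ^ (m - i)\<bar> \<le> 2 ^ (m - i)" by (auto simp: abs_mult)
      qed
      finally have "\<bar>T\<bar> \<le> 2 ^ m - 1" using geo by simp
      then have "real_of_int \<bar>T\<bar> \<le> real_of_int (2 ^ m - 1)" by (simp only: of_int_le_iff)
      then have "\<bar>of_int T\<bar> \<le> (2 ^ m - 1 :: real)" by simp
      then have T: "\<bar>of_int T / 4 ^ m\<bar> \<le> (2 ^ m - 1 :: real) / 4 ^ m"
        by (simp add: divide_right_mono)
      have four: "(4::real) ^ m = 2 ^ m * 2 ^ m" by (simp flip: power_mult_distrib)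
      have "(1::real) \<le> \<bar>of_int S\<bar>" using False by linarith
      moreover have "c \<ge> 0" by (rule order_trans[OF _ c]) simp
      ultimately have "\<bar>of_int S * c\<bar> \<ge> c" by (simp add: abs_mult mult_le_cancel_right1)
      moreover have "(2 ^ m - 1 :: real) / 4 ^ m + 1 / 4 ^ m = 1 / 2 ^ m"
        by (simp add: four field_simps)
      ultimately show ?thesis using T c unfolding s' by linarith
    qed
  next
    define \<xi> :: "nat \<Rightarrow> int" where "\<xi> i = (if i = m - 1 then 1 else if i = m then -1 else 0)" for i
    have pair: "(\<Sum>i=1..m. \<xi> i * g i) = g (m - 1) - g m" for g :: "nat \<Rightarrow> int"
    proof -
      have "(\<Sum>i=1..m. \<xi> i * g i) = (\<Sum>i\<in>{m - 1, m}. \<xi> i * g i)"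
        using m by (intro sum.mono_neutral_right) (auto simp: \<xi>_def)
      also have "\<dots> = g (m - 1) - g m" using m by (simp add: \<xi>_def)
      finally show ?thesis .
    qed
    have "(\<Sum>i=1..m. \<xi> i) = 0" using pair[of "\<lambda>_. 1"] by simp
    moreover have "(\<Sum>i=1..m. \<xi> i * 2 ^ (m - i)) = 1" using pair[of "\<lambda>i. 2 ^ (m - i)"] m by simp
    ultimately have "1 / 4 ^ m = \<bar>\<Sum>i\<in>{1..m}. of_int (\<xi> i) * ?x i\<bar>" unfolding val by simp
    moreover have "\<forall>i\<in>{1..m}. \<xi> i \<in> {-1, 0, 1}" by (simp add: \<xi>_def)
    moreover have "\<exists>i\<in>{1..m}. \<xi> i \<noteq> 0" using m by (intro bexI[of _ m]) (auto simp: \<xi>_def)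
    ultimately show "1 / 4 ^ m \<in> {\<bar>\<Sum>i\<in>{1..m}. of_int (\<xi> i) * ?x i\<bar> | \<xi> :: nat \<Rightarrow> int.
            (\<forall>i\<in>{1..m}. \<xi> i \<in> {-1, 0, 1}) \<and> (\<exists>i\<in>{1..m}. \<xi> i \<noteq> 0)}" by blast
  qed
qed

lemma block_exp_eqI:
  assumes "2 ^ n * d / 4 ^ (k + 3) = 1"
  shows "block_exp k d = n"
  unfolding block_exp_def
proof (rule the_equality)
  fix n' :: nat assume "2 ^ n' * d / 4 ^ (k + 3) = 1"
  with assms have "2 ^ n' * d = 2 ^ n * d" "d \<noteq> 0"
    by (simp_all only: divide_eq_1_iff) auto
  then show "n' = n" by simp
qed (fact assms)

lemma delta_step:
  assumes k: "k \<ge> 1" and d: "delta k = 1 / 4 ^ p"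
  defines "n \<equiv> block_exp k (delta k)"
  shows "2 ^ n * delta k / 4 ^ (k + 3) = 1" "delta (Suc k) = 1 / 4 ^ 2 ^ n"
proof -
  have "2 ^ (2 * (p + k + 3)) * delta k / 4 ^ (k + 3) = 1"
    by (simp add: d power_mult power_add)
  with block_exp_eqI n_def have n: "n = 2 * (p + k + 3)" by blast
  show 1: "2 ^ n * delta k / 4 ^ (k + 3) = 1" unfolding n by fact
  have c: "delta k / (2 * 4 ^ (k + 1)) = 8 / 2 ^ n"
    using 1 by (simp add: power_add field_simps)
  have "(2::real) ^ n \<le> 2 ^ 2 ^ n" by (intro power_increasing) (auto intro: less_imp_le)
  then have "8 / 2 ^ n \<ge> 1 / (2 ^ 2 ^ n :: real)" by (intro frac_le) auto
  moreover have "2 ^ n \<ge> (2::nat)" using power_increasing[of 1 n "2::nat"] n by simp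
  ultimately have "min_signed_sum {1..2 ^ n} (\<lambda>i. 8 / 2 ^ n + 1 / 2 ^ (2 ^ n + i)) = 1 / 4 ^ 2 ^ n"
    by (intro min_signed_sum_block)
  moreover have "block_term k (delta k) = (\<lambda>i. 8 / 2 ^ n + 1 / 2 ^ (2 ^ n + i))"
    by (intro ext) (simp only: block_term_def c n_def[symmetric])
  moreover have "delta (Suc k) = min_signed_sum {1..2 ^ n} (block_term k (delta k))"
    using k by (simp add: n_def)
  ultimately show "delta (Suc k) = 1 / 4 ^ 2 ^ n" by metis
qed

lemma delta_form: "k \<ge> 1 \<Longrightarrow> \<exists>p. delta k = 1 / 4 ^ p"
proof (induction k rule: nat_induct_at_least)
  case base
  show ?case by (intro exI[of _ 0]) simp
next
  case (Suc k)
  then show ?case using delta_step(2) by blast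
qed

lemma block_end_less: "block_end k < block_end (Suc k)" by simp

lemma block_of_eqI:
  assumes "i \<in> {block_end k<..block_end (Suc k)}"
  shows "block_of i = k"
  unfolding block_of_def
proof (rule the_equality)
  have mono: "mono block_end" using block_end_less by (intro incseq_SucI less_imp_le)
  fix k' assume k': "i \<in> {block_end k'<..block_end (Suc k')}"
  show "k' = k"
  proof (rule ccontr)
    assume "k' \<noteq> k"
    then have "Suc k' \<le> k \<or> Suc k \<le> k'" by linarith
    then show False using monoD[OF mono, of "Suc k'" k] monoD[OF mono, of "Suc k" k'] assms k'
      by (auto simp del: block_end.simps)
  qed
qed (fact assms)

lemma xseq_block:
  assumes "k \<ge> 1" "n = block_exp k (delta k)" "i \<in> {1..2 ^ n}"
  shows "xseq (block_end k + i) = delta k / (2 * 4 ^ (k + 1)) + 1 / 2 ^ (2 ^ n + i)"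
proof -
  have "block_of (block_end k + i) = k" using assms by (intro block_of_eqI) auto
  then show ?thesis using assms by (simp add: xseq_def block_term_def)
qed

lemma construction_base:
  "block_end 0 = 0" "block_end 1 = 1" "xseq 1 = 1" "delta 1 = 1"
  using block_of_eqI[of 1 0] by (simp_all add: xseq_def)

lemma construction:
  assumes "k \<ge> 1"
  obtains n where
    "2 ^ n * delta k / 4 ^ (k + 3) = 1"
    "block_end (k + 1) = block_end k + 2 ^ n"
    "\<And>i. i \<in> {1..2 ^ n} \<Longrightarrow>
       xseq (block_end k + i) = delta k / (2 * 4 ^ (k + 1)) + 1 / 2 ^ (2 ^ n + i)"
    "delta (k + 1) = min_signed_sum {block_end k + 1..block_end (k + 1)} xseq"
    "delta (k + 1) = 1 / 4 ^ 2 ^ n"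
proof -
  define n where "n = block_exp k (delta k)"
  obtain p where p: "delta k = 1 / 4 ^ p" using delta_form assms by blast
  have N: "block_end (k + 1) = block_end k + 2 ^ n" using assms by (simp add: n_def)
  have shift: "min_signed_sum {a + 1..a + m} x = min_signed_sum {1..m} (\<lambda>i. x (a + i))"
    for a m :: nat and x
  proof -
    have sum_shift: "(\<Sum>i\<in>{a + 1..a + m}. f i) = (\<Sum>i\<in>{1..m}. f (a + i))" for f :: "nat \<Rightarrow> real"
      by (rule sum.reindex_bij_witness[of _ "\<lambda>i. a + i" "\<lambda>i. i - a"]) auto
    have "{\<bar>\<Sum>i\<in>{a + 1..a + m}. of_int (\<xi> i) * x i\<bar> | \<xi> :: nat \<Rightarrow> int.
            (\<forall>i\<in>{a + 1..a + m}. \<xi> i \<in> {-1, 0, 1}) \<and> (\<exists>i\<in>{a + 1..a + m}. \<xi> i \<noteq> 0)} =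
          {\<bar>\<Sum>i\<in>{1..m}. of_int (\<xi> i) * x (a + i)\<bar> | \<xi> :: nat \<Rightarrow> int.
            (\<forall>i\<in>{1..m}. \<xi> i \<in> {-1, 0, 1}) \<and> (\<exists>i\<in>{1..m}. \<xi> i \<noteq> 0)}" (is "?L = ?R")
    proof (intro equalityI subsetI)
      fix s assume "s \<in> ?L"
      then obtain \<xi> :: "nat \<Rightarrow> int" where
        s: "s = \<bar>\<Sum>i\<in>{a + 1..a + m}. of_int (\<xi> i) * x i\<bar>"
        and \<xi>: "\<forall>i\<in>{a + 1..a + m}. \<xi> i \<in> {-1, 0, 1}"
        and "\<exists>i\<in>{a + 1..a + m}. \<xi> i \<noteq> 0" by blast
      then obtain j where j: "j \<in> {a + 1..a + m}" "\<xi> j \<noteq> 0" by blast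
      have "\<exists>i\<in>{1..m}. \<xi> (a + i) \<noteq> 0" using j by (intro bexI[of _ "j - a"]) auto
      moreover have "\<forall>i\<in>{1..m}. \<xi> (a + i) \<in> {-1, 0, 1}" using \<xi> by simp
      ultimately show "s \<in> ?R" unfolding s sum_shift
        by (intro CollectI exI[of _ "\<lambda>i. \<xi> (a + i)"]) simp
    next
      fix s assume "s \<in> ?R"
      then obtain \<xi> :: "nat \<Rightarrow> int" where
        s: "s = \<bar>\<Sum>i\<in>{1..m}. of_int (\<xi> i) * x (a + i)\<bar>"
        and \<xi>: "\<forall>i\<in>{1..m}. \<xi> i \<in> {-1, 0, 1}"
        and "\<exists>i\<in>{1..m}. \<xi> i \<noteq> 0" by blast
      then obtain j where j: "j \<in> {1..m}" "\<xi> j \<noteq> 0" by blast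
      have "\<exists>i\<in>{a + 1..a + m}. \<xi> (i - a) \<noteq> 0" using j by (intro bexI[of _ "a + j"]) auto
      moreover have "\<forall>i\<in>{a + 1..a + m}. \<xi> (i - a) \<in> {-1, 0, 1}"
      proof
        fix i assume "i \<in> {a + 1..a + m}"
        then have "i - a \<in> {1..m}" by auto
        then show "\<xi> (i - a) \<in> {-1, 0, 1}" using \<xi> by blast
      qed
      moreover have "s = \<bar>\<Sum>i\<in>{a + 1..a + m}. of_int (\<xi> (i - a)) * x i\<bar>"
        unfolding s sum_shift by simp
      ultimately show "s \<in> ?L" by (intro CollectI exI[of _ "\<lambda>i. \<xi> (i - a)"]) simp
    qed
    then show ?thesis unfolding min_signed_sum_def by (rule arg_cong[of _ _ Min])
  qed
  have cong: "min_signed_sum I f = min_signed_sum I g" if "\<And>i. i \<in> I \<Longrightarrow> f i = g i" for I f g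
  proof -
    have "(\<Sum>i\<in>I. of_int (\<xi> i) * f i) = (\<Sum>i\<in>I. of_int (\<xi> i) * g i)" for \<xi> :: "nat \<Rightarrow> int"
      using that by (intro sum.cong) auto
    then show ?thesis unfolding min_signed_sum_def by simp
  qed
  have "delta (k + 1) = min_signed_sum {1..2 ^ n} (block_term k (delta k))"
    using assms by (simp add: n_def)
  also have "\<dots> = min_signed_sum {1..2 ^ n} (\<lambda>i. xseq (block_end k + i))"
    by (rule cong) (simp add: xseq_block[OF assms n_def] block_term_def n_def)
  finally have "delta (k + 1) = min_signed_sum {block_end k + 1..block_end (k + 1)} xseq"
    unfolding N shift .
  then show thesis
    using that[OF _ N xseq_block[OF assms n_def]] delta_step[OF assms p] by (simp add: n_def)
qed

lemma yseq_block: "i \<in> {block_end k<..block_end (k + 1)} \<Longrightarrow> yseq i = 1 / 2 ^ k"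
  using block_of_eqI[of i k] by (simp add: yseq_def)

lemma delta_pos: "delta k > 0"
proof (cases k)
  case (Suc j)
  then obtain p where "delta k = 1 / 4 ^ p" using delta_form[of k] by auto
  then show ?thesis by simp
qed simp

lemma xseq_pos: "xseq i > 0"
  using delta_pos by (simp add: xseq_def Let_def block_term_def add_pos_pos)

lemma yseq_pos: "yseq i > 0"
  by (simp add: yseq_def)

end

theory Submission
  imports Defs
begin

text \<open>
  In block \<open>k \<ge> 1\<close>, of length \<open>L\<close>, the terms are nearly equal to \<open>\<plusminus>(8 / L, 1 / 2\<^sup>k)\<close>, where \<open>L \<ge> 4\<^sup>k\<^sup>+\<^sup>3\<close>.
  Thus \<open>x\<close> and \<open>y\<close> decrease to \<open>0\<close> and the series converges by Leibniz' criterion, although each such block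
  contributes at least \<open>8\<close> to the sum of \<open>x\<close> and far more to that of \<open>y\<close>. Moreover \<open>x \<le> y\<^sup>2\<close>
  (\<open>xseq_le_yseq_sq\<close>), so the terms turn vertical and only \<open>(0, 1)\<close> and \<open>(0, -1)\<close> are Levy vectors.

  Every point is the sum of a rearrangement by a greedy argument in two coordinates
  (\<open>sum_range_plane_eq_UNIV\<close>). A few terms of each block form a thin set on which \<open>y\<close> still diverges for
  both signs, whereas \<open>x\<close> converges absolutely. The second coordinate dictates the sign of the next
  term; the first coordinate then only chooses between a thin term, which hardly affects it, and
  another one, which is used only when its sign is the right one for both coordinates. Both coordinates
  cross their targets infinitely often, and therefore no term is left out.

  Two points of the achievement set on the same vertical line give coefficients \<open>\<zeta>\<^sub>i\<close> in \<open>{-1, 0, 1}\<close> for which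
  the sum of \<open>\<zeta>\<^sub>i x\<^sub>i\<close> is \<open>0\<close> and the sum of \<open>\<zeta>\<^sub>i y\<^sub>i\<close> converges; it turns out that all \<open>\<zeta>\<^sub>i\<close> vanish
  (\<open>eq_0_if_sums_0\<close>). Convergence of the second sum makes the surplus of signs in block \<open>k\<close> at most \<open>2\<^sup>k\<close> for
  large \<open>k\<close>, and then the blocks from \<open>K\<close> on contribute at most \<open>\<delta>\<^sub>K / 2\<close> to the first sum. What comes
  before is an integer multiple of \<open>\<delta>\<^sub>K\<close>, so it must be \<open>0\<close>. A descent through the finitely many remaining
  blocks, in which signed binary numbers enter that vanish only if all their digits do,
  finishes the argument.
\<close>

section \<open>A Riemann rearrangement theorem in the plane\<close>

text \<open>
  Once all steps to come are smaller than \<open>e\<close>, a walk that crosses \<open>b\<close> stays within \<open>e\<close> of \<open>b\<close>, as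
  it can overshoot only by a single step. Zero steps are allowed, because one of the two coordinates
  controlled below stands still while the other one is being corrected.
\<close>

lemma greedy_tendsto:
  fixes Z d :: "nat \<Rightarrow> real"
  assumes step: "\<And>n. Z (Suc n) = Z n + d n" and d0: "d \<longlonglongrightarrow> 0"
    and up: "\<And>n. Z n \<le> b \<Longrightarrow> d n \<ge> 0" and down: "\<And>n. \<not> Z n \<le> b \<Longrightarrow> d n \<le> 0"
    and io: "\<And>t. infinite {n. (Z n \<le> b) = t}"
  shows "Z \<longlonglongrightarrow> b"
proof (rule LIMSEQ_I)
  fix e :: real assume e: "e > 0"
  obtain n0 where n0: "\<And>n. n \<ge> n0 \<Longrightarrow> \<bar>d n\<bar> < e"
    using LIMSEQ_D[OF d0 e] by auto
  obtain n1 where n1: "n1 \<ge> n0" "Z n1 \<le> b"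
    using io[of True] unfolding infinite_nat_iff_unbounded_le by auto
  have "\<exists>n\<ge>n1. Z n \<le> b \<and> Z (Suc n) > b"
  proof (rule ccontr)
    assume contr: "\<not> ?thesis"
    have "Z n \<le> b" if "n \<ge> n1" for n
      using that by (induction n rule: dec_induct) (use n1 contr in \<open>auto simp: not_less\<close>)
    moreover obtain n2 where "n2 \<ge> n1" "\<not> Z n2 \<le> b"
      using io[of False] unfolding infinite_nat_iff_unbounded_le by auto
    ultimately show False by blast
  qed
  then obtain n where n: "n \<ge> n1" "Z n \<le> b" "Z (Suc n) > b" by blast
  have "\<bar>Z k - b\<bar> < e" if "k \<ge> n" for k
    using that
  proof (induction k rule: dec_induct)
    case base
    have "\<bar>d n\<bar> < e" using n0 n n1 by simp
    then show ?case using n step[of n] by simp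
  next
    case (step k)
    have "\<bar>d k\<bar> < e" using n0 n n1 step.hyps by simp
    then show ?case using step.IH assms(1)[of k] up[of k] down[of k] by linarith
  qed
  then show "\<exists>n. \<forall>k\<ge>n. norm (Z k - b) < e" by auto
qed

lemma summable_if_eventually_nonneg_bounded:
  fixes f :: "nat \<Rightarrow> real"
  assumes nonneg: "\<And>n. n \<ge> N \<Longrightarrow> f n \<ge> 0" and bound: "\<And>n. n \<ge> N \<Longrightarrow> sum f {..<n} \<le> B"
  shows "summable (\<lambda>n. \<bar>f n\<bar>)"
proof -
  have "summable (\<lambda>n. \<bar>f (n + N)\<bar>)"
  proof (rule summableI_nonneg_bounded)
    fix n
    have "sum f {..<n + N} = sum f {..<N} + (\<Sum>i<n. f (i + N))"
      by (induction n) (simp_all add: add.commute add.left_commute)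
    moreover have "(\<Sum>i<n. \<bar>f (i + N)\<bar>) = (\<Sum>i<n. f (i + N))"
      by (intro sum.cong) (auto simp: nonneg)
    ultimately show "(\<Sum>i<n. \<bar>f (i + N)\<bar>) \<le> B - sum f {..<N}" using bound[of "n + N"] by simp
  qed simp
  then show ?thesis by (subst (asm) summable_iff_shift)
qed

lemma card_below_unbounded:
  assumes "infinite (S :: nat set)"
  obtains n0 where "\<And>n. n \<ge> n0 \<Longrightarrow> card {m \<in> S. m < n} > K"
proof -
  obtain F where F: "F \<subseteq> S" "finite F" "card F = Suc K"
    using infinite_arbitrarily_large[OF assms] by blast
  have "card {m \<in> S. m < n} > K" if "n \<ge> Suc (Max F)" for n
  proof -
    have "F \<subseteq> {m \<in> S. m < n}" using F that by (force dest: Max_ge)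
    then have "card F \<le> card {m \<in> S. m < n}" by (intro card_mono) auto
    then show ?thesis using F by simp
  qed
  then show thesis using that by blast
qed

lemma eventually_not_if_finite:
  assumes "finite {n :: nat. P n = t}"
  shows "\<exists>N. \<forall>n\<ge>N. P n = (\<not> t)"
proof -
  obtain N where "{n. P n = t} \<subseteq> {..<N}" using assms finite_nat_iff_bounded by blast
  then have "\<forall>n\<ge>N. P n = (\<not> t)" by (auto simp: subset_iff not_less[symmetric])
  then show ?thesis ..
qed

text \<open>
  The indices are split by the sign of \<open>y\<close> and by membership in \<open>M\<close>. The terms outside \<open>M\<close> can steer
  \<open>y\<close> all by themselves, while their total effect on \<open>x\<close> is a fixed absolutely convergent sum; so only the
  terms in \<open>M\<close> have to steer \<open>x\<close>. At each step the sign of the next term is dictated by \<open>y\<close>: positive if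
  the current sum of \<open>y\<close> is at most \<open>b\<close>, negative otherwise. What is left free is whether the term comes
  from \<open>M\<close>, and a term from \<open>M\<close> is taken only if its sign also moves the sum of \<open>x\<close> towards \<open>a\<close>.
\<close>

locale greedy_rearrangement =
  fixes x y :: "nat \<Rightarrow> real" and M :: "nat set" and a b :: real
  assumes x_tendsto: "x \<longlonglongrightarrow> 0" and y_tendsto: "y \<longlonglongrightarrow> 0"
    and sign: "\<And>i. i \<in> M \<Longrightarrow> y i > 0 \<Longrightarrow> x i \<ge> 0" "\<And>i. i \<in> M \<Longrightarrow> \<not> y i > 0 \<Longrightarrow> x i \<le> 0"
    and x_diverges: "\<And>s. \<not> x summable_on {i \<in> M. (y i > 0) = s}"
    and y_diverges: "\<And>s. \<not> y summable_on {i \<in> - M. (y i > 0) = s}"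
begin

definition queue :: "bool \<times> bool \<Rightarrow> nat set" where
  "queue q = {i. (y i > 0) = fst q \<and> (i \<in> M) = snd q}"

lemma x_diverges_queue: "\<not> x summable_on queue (s, True)"
  using x_diverges[of s] by (simp add: queue_def conj_commute)

lemma y_diverges_queue: "\<not> y summable_on queue (s, False)"
  using y_diverges[of s] by (simp add: queue_def conj_commute)

text \<open>
  The comparison of cardinalities keeps \<open>M\<close> from starving the terms outside \<open>M\<close>: without it, the
  errors of the two coordinates could have the same sign forever, and then only terms from \<open>M\<close> would be
  used. The state of the process is the finite set \<open>U\<close> of the indices used so far.
\<close>

definition choose_queue :: "nat set \<Rightarrow> bool \<times> bool" where
  "choose_queue U = (let s = (sum y U \<le> b) in
     (s, (sum x (U \<inter> M) \<le> a) = s \<and> card (U \<inter> queue (s, True)) \<le> card (U \<inter> queue (s, False))))"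

primrec used :: "nat \<Rightarrow> nat set" where
  "used 0 = {}"
| "used (Suc n) = insert (LEAST i. i \<in> queue (choose_queue (used n)) - used n) (used n)"

definition \<sigma> :: "nat \<Rightarrow> nat" where
  "\<sigma> n = (LEAST i. i \<in> queue (choose_queue (used n)) - used n)"

definition chosen :: "nat \<Rightarrow> bool \<times> bool" where "chosen n = choose_queue (used n)"

definition X :: "nat \<Rightarrow> real" where "X n = sum x (used n \<inter> M)"

definition Y :: "nat \<Rightarrow> real" where "Y n = sum y (used n)"

lemma infinite_queue: "infinite (queue q)"
proof (cases q)
  case (Pair s m)
  then show ?thesis using x_diverges_queue[of s] y_diverges_queue[of s] by (cases m) auto
qed

lemma finite_used: "finite (used n)"
  by (induction n) auto

lemma \<sigma>_fresh: "\<sigma> n \<in> queue (chosen n) - used n"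
proof -
  have "infinite (queue (chosen n) - used n)"
    by (rule Diff_infinite_finite[OF finite_used infinite_queue])
  then have "\<exists>i. i \<in> queue (chosen n) - used n" using infinite_imp_nonempty by blast
  then show ?thesis unfolding \<sigma>_def chosen_def by (rule LeastI_ex)
qed

lemma used_Suc: "used (Suc n) = insert (\<sigma> n) (used n)"
  by (simp add: \<sigma>_def)

declare used.simps(2) [simp del]

lemma used_eq: "used n = \<sigma> ` {..<n}"
  by (induction n) (auto simp: used_Suc lessThan_Suc)

lemma inj_\<sigma>: "inj \<sigma>"
proof (rule linorder_injI)
  fix i j :: nat assume "i < j"
  then have "\<sigma> i \<in> used j" by (simp add: used_eq)
  then show "\<sigma> i \<noteq> \<sigma> j" using \<sigma>_fresh[of j] by auto
qed

lemma Y_eq: "Y n = (\<Sum>m<n. y (\<sigma> m))"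
  unfolding Y_def used_eq by (subst sum.reindex) (auto intro: inj_on_subset[OF inj_\<sigma>])

lemma X_eq: "X n = (\<Sum>m<n. if \<sigma> m \<in> M then x (\<sigma> m) else 0)"
proof -
  have "X n = (\<Sum>i\<in>used n. if i \<in> M then x i else 0)"
    unfolding X_def by (rule sum.inter_restrict[OF finite_used])
  also have "\<dots> = (\<Sum>m<n. if \<sigma> m \<in> M then x (\<sigma> m) else 0)"
    unfolding used_eq by (subst sum.reindex) (auto intro: inj_on_subset[OF inj_\<sigma>])
  finally show ?thesis .
qed

lemma card_used_queue: "card (used n \<inter> queue q) = card {m \<in> {m. chosen m = q}. m < n}"
proof -
  have "\<sigma> m \<in> queue q \<longleftrightarrow> chosen m = q" for m
    using \<sigma>_fresh[of m] unfolding queue_def by (auto intro: prod_eqI)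
  then have "used n \<inter> queue q = \<sigma> ` {m \<in> {m. chosen m = q}. m < n}"
    unfolding used_eq by auto
  then show ?thesis by (simp add: card_image inj_on_subset[OF inj_\<sigma>])
qed

lemma \<sigma>_sign: "y (\<sigma> n) > 0 \<longleftrightarrow> fst (chosen n)" and \<sigma>_M: "\<sigma> n \<in> M \<longleftrightarrow> snd (chosen n)"
  using \<sigma>_fresh[of n] unfolding queue_def by auto

lemma fst_chosen: "fst (chosen n) \<longleftrightarrow> Y n \<le> b"
  by (simp add: chosen_def choose_queue_def Y_def Let_def)

lemma snd_chosen:
  "snd (chosen n) \<longleftrightarrow> (X n \<le> a) = fst (chosen n) \<and>
     card {m \<in> {m. chosen m = (fst (chosen n), True)}. m < n} \<le> card {m \<in> {m. chosen m = (fst (chosen n), False)}. m < n}"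
  unfolding card_used_queue[symmetric] by (simp add: chosen_def choose_queue_def X_def Let_def)

text \<open>
  By the comparison of cardinalities, the uses of the two queues of sign \<open>s\<close> are balanced in such a way
  that those in \<open>M\<close> exceed the others by at most one.
\<close>

lemma infinite_chosen_outside_M:
  assumes "infinite {n. fst (chosen n) = s}"
  shows "infinite {n. chosen n = (s, False)}" (is "infinite ?F")
proof
  assume fin: "finite ?F"
  let ?T = "{n. chosen n = (s, True)}"
  have "{n. fst (chosen n) = s} \<subseteq> ?T \<union> ?F" by (auto simp: prod_eq_iff)
  then have inf: "infinite ?T" using assms fin finite_subset by blast
  then obtain n0 where n0: "\<And>n. n \<ge> n0 \<Longrightarrow> card {m \<in> ?T. m < n} > card ?F"
    using card_below_unbounded by blast
  obtain n where n: "n \<ge> n0" "chosen n = (s, True)"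
    using inf unfolding infinite_nat_iff_unbounded_le by auto
  have "card {m \<in> ?T. m < n} \<le> card {m \<in> ?F. m < n}" using snd_chosen[of n] n by simp
  also have "\<dots> \<le> card ?F" using fin by (intro card_mono) auto
  finally show False using n0[OF n(1)] by simp
qed

text \<open>
  Conversely, the terms outside \<open>M\<close> soon outnumber any finite number of terms in \<open>M\<close>. From then on only
  the side of \<open>X\<close> could prevent a term in \<open>M\<close> from being taken.
\<close>

lemma infinite_chosen_in_M_if_eventually:
  assumes inf: "infinite {n. fst (chosen n) = t}" and ev: "\<And>n. n \<ge> N \<Longrightarrow> (X n \<le> a) = t"
  shows "infinite {n. chosen n = (t, True)}" (is "infinite ?T")
proof
  assume fin: "finite ?T"
  let ?F = "{n. chosen n = (t, False)}"
  obtain n0 where n0: "\<And>n. n \<ge> n0 \<Longrightarrow> card {m \<in> ?F. m < n} > card ?T"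
    using card_below_unbounded[OF infinite_chosen_outside_M[OF inf]] by blast
  have "n \<in> ?T" if n: "n \<ge> max N n0" "fst (chosen n) = t" for n
  proof -
    have "card {m \<in> ?T. m < n} \<le> card ?T" using fin by (intro card_mono) auto
    also have "\<dots> < card {m \<in> ?F. m < n}" using n0 n by simp
    finally have "snd (chosen n)" using n ev snd_chosen[of n] by simp
    then show ?thesis using n(2) by (auto intro: prod_eqI)
  qed
  then have "{n. fst (chosen n) = t} \<subseteq> ?T \<union> {..<max N n0}" by (auto simp: not_less)
  then show False using fin inf finite_subset by blast
qed

text \<open>
  The least unused index is taken each time, so an index that is never used bounds all the indices that
  are taken from its queue, and there are infinitely many of these.
\<close>

lemma queue_exhausted:
  assumes "infinite {n. chosen n = q}"
  shows "queue q \<subseteq> range \<sigma>"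
proof (rule ccontr)
  assume "\<not> ?thesis"
  then obtain i where i: "i \<in> queue q" "i \<notin> range \<sigma>" by blast
  have "\<sigma> n \<le> i" if "chosen n = q" for n
  proof -
    have "i \<in> queue (choose_queue (used n)) - used n" using i that by (auto simp: used_eq chosen_def)
    then show ?thesis unfolding \<sigma>_def by (rule Least_le)
  qed
  then have "\<sigma> ` {n. chosen n = q} \<subseteq> {..i}" by auto
  then have "finite (\<sigma> ` {n. chosen n = q})" using finite_subset by blast
  then show False using assms finite_imageD inj_on_subset[OF inj_\<sigma>] by blast
qed

text \<open>
  This turns every failure of the process into a contradiction: if a coordinate is eventually pushed only
  towards a bound that it does not cross, then its increments are absolutely summable, hence so is every
  queue that has been used up. The factor \<open>c\<close> serves to treat both directions at once.
\<close>

lemma summable_on_queue: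
  fixes f :: "nat \<Rightarrow> real" and c :: real
  assumes c: "c \<noteq> 0" and nonneg: "\<And>n. n \<ge> N \<Longrightarrow> c * f (\<sigma> n) \<ge> 0"
    and bound: "\<And>n. n \<ge> N \<Longrightarrow> c * (\<Sum>m<n. f (\<sigma> m)) \<le> B"
    and inf: "infinite {n. chosen n = q}"
  shows "f summable_on queue q"
proof -
  have "summable (\<lambda>n. \<bar>c * f (\<sigma> n)\<bar>)"
    using nonneg bound by (intro summable_if_eventually_nonneg_bounded[of N _ B])
       (auto simp: sum_distrib_left)
  then have "summable (\<lambda>n. \<bar>f (\<sigma> n)\<bar>)"
    using c by (simp add: abs_mult summable_cmult_iff)
  then have "(\<lambda>n. f (\<sigma> n)) summable_on UNIV"
    by (intro norm_summable_imp_summable_on) simp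
  then have "f summable_on range \<sigma>"
    by (subst summable_on_reindex) (auto simp: inj_\<sigma> o_def)
  then show ?thesis by (rule summable_on_subset_banach[OF _ queue_exhausted[OF inf]])
qed

text \<open>
  If one sign were used only finitely often, then \<open>y\<close> would be pushed monotonically by the other sign
  without crossing \<open>b\<close>, although the terms outside \<open>M\<close> of that sign are used up and have a divergent sum.
\<close>

lemma infinite_fst_chosen: "infinite {n. fst (chosen n) = s}"
proof
  assume "finite {n. fst (chosen n) = s}"
  from eventually_not_if_finite[OF this] obtain N
    where N: "\<And>n. n \<ge> N \<Longrightarrow> fst (chosen n) = (\<not> s)" by auto
  then have "{N..} \<subseteq> {n. fst (chosen n) = (\<not> s)}" by auto
  then have "infinite {n. fst (chosen n) = (\<not> s)}" by (rule infinite_super) (rule infinite_Ici)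
  then have inf: "infinite {n. chosen n = (\<not> s, False)}" by (rule infinite_chosen_outside_M)
  define c :: real where "c = (if s then -1 else 1)"
  have "y summable_on queue (\<not> s, False)"
  proof (rule summable_on_queue[where N = N and c = c and B = "c * b"])
    fix n assume "n \<ge> N"
    then have "fst (chosen n) = (\<not> s)" by (rule N)
    then show "c * y (\<sigma> n) \<ge> 0" "c * (\<Sum>m<n. y (\<sigma> m)) \<le> c * b"
      using \<sigma>_sign[of n] fst_chosen[of n] unfolding Y_eq[symmetric] c_def by (auto split: if_splits)
  qed (auto simp: c_def inf)
  then show False using y_diverges_queue by blast
qed

lemma x_step_sign:
  "X n \<le> a \<Longrightarrow> (if \<sigma> n \<in> M then x (\<sigma> n) else 0) \<ge> 0"
  "\<not> X n \<le> a \<Longrightarrow> (if \<sigma> n \<in> M then x (\<sigma> n) else 0) \<le> 0"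
  using sign[of "\<sigma> n"] \<sigma>_sign[of n] \<sigma>_M[of n] snd_chosen[of n] by auto

text \<open>
  If \<open>X\<close> eventually stayed on one side of \<open>a\<close>, then terms of \<open>M\<close> would be used with one sign only,
  and infinitely often, because both signs are demanded by \<open>y\<close> infinitely often. This contradicts the
  divergence of \<open>x\<close> on that part of \<open>M\<close>.
\<close>

lemma infinite_X_le: "infinite {n. (X n \<le> a) = t}"
proof
  assume "finite {n. (X n \<le> a) = t}"
  from eventually_not_if_finite[OF this] obtain N
    where N: "\<And>n. n \<ge> N \<Longrightarrow> (X n \<le> a) = (\<not> t)" by auto
  have inf: "infinite {n. chosen n = (\<not> t, True)}"
    using infinite_fst_chosen N by (rule infinite_chosen_in_M_if_eventually)
  define c :: real where "c = (if t then -1 else 1)"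
  have "(\<lambda>i. if i \<in> M then x i else 0) summable_on queue (\<not> t, True)"
  proof (rule summable_on_queue[where N = N and c = c and B = "c * a"])
    fix n assume "n \<ge> N"
    then have "(X n \<le> a) = (\<not> t)" by (rule N)
    then show "c * (if \<sigma> n \<in> M then x (\<sigma> n) else 0) \<ge> 0"
      "c * (\<Sum>m<n. if \<sigma> m \<in> M then x (\<sigma> m) else 0) \<le> c * a"
      using x_step_sign[of n] unfolding X_eq[symmetric] c_def by (auto split: if_splits)
  qed (auto simp: c_def inf)
  then have "x summable_on queue (\<not> t, True)"
    by (rule summable_on_cong[THEN iffD1, rotated]) (auto simp: queue_def)
  then show False using x_diverges_queue by blast
qed

text \<open>
  Only a term of \<open>M\<close> of the right sign can bring \<open>X\<close> from one side of \<open>a\<close> to the other, and \<open>X\<close>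
  changes sides infinitely often. So the terms of \<open>M\<close> are not starved either.
\<close>

lemma infinite_chosen: "infinite {n. chosen n = q}"
proof (cases q)
  case (Pair s m)
  show ?thesis
  proof (cases m)
    case False
    then show ?thesis using Pair infinite_chosen_outside_M[OF infinite_fst_chosen] by simp
  next
    case True
    show ?thesis
    proof
      assume "finite {n. chosen n = q}"
      then obtain N where N: "\<And>n. n \<ge> N \<Longrightarrow> chosen n \<noteq> (s, True)"
        using eventually_not_if_finite[of "\<lambda>n. chosen n = q" True] Pair True by auto
      obtain n0 where n0: "n0 \<ge> N" "(X n0 \<le> a) = s"
        using infinite_X_le[of s] unfolding infinite_nat_iff_unbounded_le by auto
      have "(X n \<le> a) = s" if "n \<ge> n0" for n
        using that
      proof (induction n rule: dec_induct)
        case (step n)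
        have "\<sigma> n \<notin> M"
        proof
          assume "\<sigma> n \<in> M"
          then have "snd (chosen n)" by (simp add: \<sigma>_M)
          moreover from this have "fst (chosen n) = s" using step.IH snd_chosen[of n] by simp
          ultimately have "chosen n = (s, True)" by (auto intro: prod_eqI)
          then show False using N n0 step.hyps by auto
        qed
        then show ?case using step.IH by (simp add: X_eq)
      qed (use n0 in simp)
      then have "{n. (X n \<le> a) = (\<not> s)} \<subseteq> {..<n0}" by (auto simp: not_less[symmetric])
      then show False using infinite_X_le finite_subset by blast
    qed
  qed
qed

lemma bij_\<sigma>: "bij \<sigma>"
proof -
  have "i \<in> range \<sigma>" for i
    using queue_exhausted[OF infinite_chosen, of "(y i > 0, i \<in> M)"] by (auto simp: queue_def)
  then show ?thesis using inj_\<sigma> by (auto simp: bij_def)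
qed

lemma \<sigma>_at_top: "filterlim \<sigma> at_top sequentially"
proof (unfold filterlim_at_top, intro allI)
  fix k
  have "finite {n. \<not> k \<le> \<sigma> n}"
    using finite_vimageI[OF finite_lessThan inj_\<sigma>, of k] by (simp add: vimage_def not_le lessThan_def)
  then show "eventually (\<lambda>n. k \<le> \<sigma> n) sequentially"
    by (simp add: eventually_cofinite flip: cofinite_eq_sequentially)
qed

lemma y_sums: "(\<lambda>n. y (\<sigma> n)) sums b"
proof -
  have "Y \<longlonglongrightarrow> b"
  proof (rule greedy_tendsto)
    show "(\<lambda>n. y (\<sigma> n)) \<longlonglongrightarrow> 0" using y_tendsto \<sigma>_at_top by (rule filterlim_compose)
    show "infinite {n. (Y n \<le> b) = t}" for t using infinite_fst_chosen by (simp add: fst_chosen)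
    show "y (\<sigma> n) \<ge> 0" if "Y n \<le> b" for n using that \<sigma>_sign[of n] by (simp add: fst_chosen)
    show "y (\<sigma> n) \<le> 0" if "\<not> Y n \<le> b" for n using that \<sigma>_sign[of n] by (simp add: fst_chosen)
  qed (simp add: Y_eq)
  then show ?thesis by (simp add: sums_def Y_eq[abs_def])
qed

lemma main_x_sums: "(\<lambda>n. if \<sigma> n \<in> M then x (\<sigma> n) else 0) sums a"
proof -
  have "X \<longlonglongrightarrow> a"
  proof (rule greedy_tendsto)
    have "(\<lambda>n. x (\<sigma> n)) \<longlonglongrightarrow> 0" using x_tendsto \<sigma>_at_top by (rule filterlim_compose)
    then show "(\<lambda>n. if \<sigma> n \<in> M then x (\<sigma> n) else 0) \<longlonglongrightarrow> 0"
      by (rule Lim_null_comparison[OF _ tendsto_norm_zero, rotated]) auto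
  qed (use infinite_X_le x_step_sign in \<open>auto simp: X_eq\<close>)
  then show ?thesis by (simp add: sums_def X_eq[abs_def])
qed

end

lemma sums_Pair_iff: "(\<lambda>n. (f n, g n)) sums (a, b) \<longleftrightarrow> f sums a \<and> g sums b"
proof -
  have eq: "(\<lambda>n. \<Sum>i<n. (f i, g i)) = (\<lambda>n. (\<Sum>i<n. f i, \<Sum>i<n. g i))"
    by (simp add: sum_prod)
  show ?thesis
    unfolding sums_def eq
  proof (intro iffI conjI; (elim conjE)?)
    assume lim: "(\<lambda>n. (\<Sum>i<n. f i, \<Sum>i<n. g i)) \<longlonglongrightarrow> (a, b)"
    show "(\<lambda>n. \<Sum>i<n. f i) \<longlonglongrightarrow> a" using tendsto_fst[OF lim] by simp
    show "(\<lambda>n. \<Sum>i<n. g i) \<longlonglongrightarrow> b" using tendsto_snd[OF lim] by simp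
  qed (rule tendsto_Pair)
qed

text \<open>
  The sum \<open>G\<close> of \<open>x\<close> outside \<open>M\<close> does not depend on the rearrangement, so it suffices to let the greedy
  process steer \<open>x\<close> on \<open>M\<close> to \<open>a - G\<close>.
\<close>

lemma sum_range_plane_eq_UNIV:
  fixes x y :: "nat \<Rightarrow> real" and M :: "nat set"
  assumes x_tendsto: "x \<longlonglongrightarrow> 0" and y_tendsto: "y \<longlonglongrightarrow> 0"
    and sign: "\<And>i. i \<in> M \<Longrightarrow> y i > 0 \<Longrightarrow> x i \<ge> 0" "\<And>i. i \<in> M \<Longrightarrow> \<not> y i > 0 \<Longrightarrow> x i \<le> 0"
    and x_summable: "x summable_on - M"
    and x_diverges: "\<And>s. \<not> x summable_on {i \<in> M. (y i > 0) = s}"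
    and y_diverges: "\<And>s. \<not> y summable_on {i \<in> - M. (y i > 0) = s}"
  shows "sum_range (\<lambda>i. (x i, y i)) = UNIV"
proof (rule UNIV_eq_I[symmetric])
  fix p :: "real \<times> real"
  obtain a b where p: "p = (a, b)" by fastforce
  define g where "g i = (if i \<in> M then 0 else x i)" for i
  have "g summable_on UNIV"
    by (rule summable_on_cong_neutral[THEN iffD1, OF _ _ _ x_summable]) (auto simp: g_def)
  then obtain G where G: "(g has_sum G) UNIV" by (auto simp: summable_on_def)
  interpret greedy_rearrangement x y M "a - G" b
    by unfold_locales (use assms in auto)
  have "((\<lambda>n. g (\<sigma> n)) has_sum G) UNIV"
    using G bij_\<sigma> has_sum_reindex_bij_betw by blast
  then have "(\<lambda>n. g (\<sigma> n)) sums G" by (rule has_sum_imp_sums)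
  from sums_add[OF main_x_sums this] have "(\<lambda>n. x (\<sigma> n)) sums a"
    by (simp add: g_def if_distrib cong: if_cong)
  with y_sums have "(\<lambda>n. (x (\<sigma> n), y (\<sigma> n))) sums p"
    unfolding p by (simp add: sums_Pair_iff)
  then show "p \<in> sum_range (\<lambda>i. (x i, y i))" using bij_\<sigma> by (auto simp: sum_range_def)
qed

section \<open>The blocks of the construction\<close>

text \<open>
  The series starts at index \<open>1\<close> but is indexed from \<open>0\<close> in the theorem, so its terms are those at
  \<open>Suc i\<close>. The \<open>k\<close>-th block \<open>(N\<^sub>k, N\<^sub>k\<^sub>+\<^sub>1]\<close> thereby becomes \<open>{block_end k..<block_end (Suc k)}\<close>.
\<close>

definition block_len :: "nat \<Rightarrow> nat" where
  "block_len k = block_end (Suc k) - block_end k"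

lemma block_end_add_len: "block_end (Suc k) = block_end k + block_len k"
  using block_end_less[of k] by (simp add: block_len_def)

declare block_end.simps(2) [simp del] delta.simps(2) [simp del]

lemma block_end_1 [simp]: "block_end (Suc 0) = 1"
  using construction_base(2) by simp

lemma block_recursion:
  assumes "k \<ge> 1"
  shows block_len_eq_power: "\<exists>n. block_len k = 2 ^ n"
    and delta_block_len: "delta k * block_len k = 4 ^ (k + 3)"
    and delta_Suc_eq: "delta (Suc k) = 1 / 4 ^ block_len k"
    and xseq_in_block: "j < block_len k \<Longrightarrow>
       xseq (Suc (block_end k + j)) = 8 / block_len k + 1 / 2 ^ (block_len k + Suc j)"
proof -
  obtain n where n: "2 ^ n * delta k / 4 ^ (k + 3) = 1"
    "block_end (k + 1) = block_end k + 2 ^ n"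
    and x: "\<forall>i\<in>{1..2 ^ n}. xseq (block_end k + i) = delta k / (2 * 4 ^ (k + 1)) + 1 / 2 ^ (2 ^ n + i)"
    and d: "delta (k + 1) = 1 / 4 ^ 2 ^ n"
    by (rule construction[OF assms]) (rule that; blast)
  have len: "block_len k = 2 ^ n" using n(2) by (simp add: block_len_def)
  then show "\<exists>n. block_len k = 2 ^ n" ..
  show "delta k * block_len k = 4 ^ (k + 3)" using n(1) by (simp add: len field_simps)
  show "delta (Suc k) = 1 / 4 ^ block_len k" using d by (simp add: len)
  have "delta k / (2 * 4 ^ (k + 1)) = 8 / block_len k"
    using n(1) by (simp add: len power_add field_simps)
  then show "xseq (Suc (block_end k + j)) = 8 / block_len k + 1 / 2 ^ (block_len k + Suc j)"
    if "j < block_len k"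
    using x that by (force simp: len)
qed

lemma delta_le_1: "delta k \<le> 1"
proof (cases "k \<ge> 1")
  case True
  then obtain p where "delta k = 1 / 4 ^ p" using delta_form by blast
  then show ?thesis by simp
qed (simp add: not_le)

lemma block_len_ge:
  assumes "k \<ge> 1"
  shows "real (block_len k) \<ge> 4 ^ (k + 3)"
proof -
  have "delta k * real (block_len k) \<le> 1 * real (block_len k)"
    by (intro mult_right_mono delta_le_1) simp
  then show ?thesis using delta_block_len[OF assms] by simp
qed

lemma block_len_pos: "block_len k > 0"
  using block_end_less[of k] by (simp add: block_len_def)

lemma block_len_grows:
  assumes "k \<ge> 1"
  shows "block_len (Suc k) \<ge> 2 * block_len k"
proof -
  have "delta (Suc k) * block_len (Suc k) = 4 ^ (Suc k + 3)"
    by (rule delta_block_len) simp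
  then have eq: "real (block_len (Suc k)) = 4 ^ (Suc k + 3) * 4 ^ block_len k"
    by (simp add: delta_Suc_eq[OF assms] field_simps)
  have "real (block_len k) \<le> 2 ^ block_len k" using of_nat_less_two_power less_imp_le by blast
  also have "(2::real) ^ block_len k \<le> 4 ^ block_len k" by (rule power_mono) auto
  finally have "real (block_len k) \<le> 4 ^ block_len k" .
  moreover have "(2::real) \<le> 4 ^ (Suc k + 3)"
    using power_increasing[of 1 "Suc k + 3" "4::real"] by simp
  ultimately have "2 * real (block_len k) \<le> real (block_len (Suc k))"
    unfolding eq by (intro mult_mono) auto
  then show ?thesis by linarith
qed

lemma mono_block_end: "mono block_end"
  using block_end_less by (intro incseq_SucI less_imp_le)

lemma block_cases:
  obtains k where "block_end k \<le> i" "i < block_end (Suc k)"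
proof -
  have "\<exists>k. block_end k \<le> i \<and> i < block_end (Suc k)"
  proof (induction i)
    case 0
    show ?case by (rule exI[of _ 0]) simp
  next
    case (Suc i)
    then obtain k where k: "block_end k \<le> i" "i < block_end (Suc k)" by blast
    show ?case
    proof (cases "Suc i < block_end (Suc k)")
      case True
      then show ?thesis using k by (intro exI[of _ k]) simp
    next
      case False
      then have "Suc i = block_end (Suc k)" using k by simp
      then show ?thesis using block_end_less[of "Suc k"] by (metis order_refl)
    qed
  qed
  then show thesis using that by blast
qed

lemma block_of_Suc:
  assumes "block_end k \<le> i" "i < block_end (Suc k)"
  shows "block_of (Suc i) = k"
  using assms by (intro block_of_eqI) auto

lemma yseq_Suc:
  assumes "block_end k \<le> i" "i < block_end (Suc k)"
  shows "yseq (Suc i) = 1 / 2 ^ k"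
  using block_of_Suc[OF assms] by (simp add: yseq_def)

lemma yseq_le:
  assumes "block_end k \<le> i"
  shows "yseq (Suc i) \<le> 1 / 2 ^ k"
proof -
  obtain j where j: "block_end j \<le> i" "i < block_end (Suc j)" by (rule block_cases)
  have "k \<le> j"
  proof (rule ccontr)
    assume "\<not> k \<le> j"
    then have "block_end (Suc j) \<le> block_end k" by (intro monoD[OF mono_block_end]) simp
    then show False using j assms by simp
  qed
  then have "(2::real) ^ k \<le> 2 ^ j" by (rule power_increasing) simp
  then show ?thesis using yseq_Suc[OF j] by (simp add: frac_le)
qed

lemma xseq_bounds:
  assumes k: "k \<ge> 1" and i: "block_end k \<le> i" "i < block_end (Suc k)"
  shows "8 / block_len k \<le> xseq (Suc i)" "xseq (Suc i) \<le> 9 / block_len k"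
proof -
  have xi: "xseq (Suc i) = 8 / block_len k + 1 / 2 ^ (block_len k + Suc (i - block_end k))"
    using xseq_in_block[OF k, of "i - block_end k"] i by (simp add: block_end_add_len)
  then show "8 / block_len k \<le> xseq (Suc i)" by simp
  have "real (block_len k) \<le> 2 ^ block_len k" using of_nat_less_two_power less_imp_le by blast
  also have "\<dots> \<le> 2 ^ (block_len k + Suc (i - block_end k))" by (rule power_increasing) auto
  finally have "1 / 2 ^ (block_len k + Suc (i - block_end k)) \<le> 1 / real (block_len k)"
    using block_len_pos[of k] by (intro frac_le) auto
  then show "xseq (Suc i) \<le> 9 / block_len k" unfolding xi by (simp add: field_simps)
qed

lemma xseq_1: "xseq (Suc 0) = 1"
  using construction_base(3) by simp

text \<open>
  This single inequality shows both that the terms become vertical and that \<open>x\<close> tends to \<open>0\<close>. In block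
  \<open>k \<ge> 1\<close> it reduces to \<open>9 / L \<le> 1 / 4\<^sup>k\<close>, where the length \<open>L\<close> of the block is at least \<open>4\<^sup>k\<^sup>+\<^sup>3\<close>.
\<close>

lemma xseq_le_yseq_sq: "xseq (Suc i) \<le> (yseq (Suc i))\<^sup>2"
proof -
  obtain k where k: "block_end k \<le> i" "i < block_end (Suc k)" by (rule block_cases)
  show ?thesis
  proof (cases "k \<ge> 1")
    case True
    have "xseq (Suc i) \<le> 9 / real (block_len k)" by (rule xseq_bounds(2)[OF True k])
    also have "\<dots> \<le> 9 / 4 ^ (k + 3)" using block_len_ge[OF True] by (intro frac_le) auto
    also have "\<dots> \<le> 1 / 4 ^ k" by (simp add: power_add field_simps)
    also have "\<dots> = (yseq (Suc i))\<^sup>2"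
      by (simp add: yseq_Suc[OF k] power_divide power2_eq_square flip: power_mult_distrib)
    finally show ?thesis .
  next
    case False
    then have "k = 0" by simp
    then have "i = 0" using k by simp
    then show ?thesis using yseq_Suc[OF k] \<open>k = 0\<close> by (simp add: xseq_1)
  qed
qed

lemma yseq_le_1: "yseq i \<le> 1"
  by (simp add: yseq_def)

lemma xseq_le_yseq: "xseq (Suc i) \<le> yseq (Suc i)"
proof -
  have "(yseq (Suc i))\<^sup>2 \<le> yseq (Suc i)"
    using yseq_le_1[of "Suc i"] yseq_pos[of "Suc i"] by (simp add: power2_eq_square mult_left_le)
  then show ?thesis using xseq_le_yseq_sq[of i] by simp
qed

lemma yseq_tendsto: "(\<lambda>i. yseq (Suc i)) \<longlonglongrightarrow> 0"
proof (rule LIMSEQ_I)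
  fix e :: real assume "e > 0"
  then obtain k where "(1 / 2) ^ k < e" using real_arch_pow_inv[of e "1 / 2"] by auto
  then have "norm (yseq (Suc i) - 0) < e" if "i \<ge> block_end k" for i
    using yseq_le[OF that] yseq_pos[of "Suc i"] by (simp add: power_one_over)
  then show "\<exists>N. \<forall>i\<ge>N. norm (yseq (Suc i) - 0) < e" by blast
qed

lemma xseq_tendsto: "(\<lambda>i. xseq (Suc i)) \<longlonglongrightarrow> 0"
  by (rule tendsto_sandwich[OF _ _ tendsto_const yseq_tendsto])
     (auto simp: xseq_le_yseq intro!: always_eventually less_imp_le[OF xseq_pos])

lemma decseq_yseq: "decseq (\<lambda>i. yseq (Suc i))"
proof (rule decseq_SucI)
  fix i
  obtain k where k: "block_end k \<le> i" "i < block_end (Suc k)" by (rule block_cases)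
  show "yseq (Suc (Suc i)) \<le> yseq (Suc i)"
    using yseq_le[of k "Suc i"] yseq_Suc[OF k] k by simp
qed

lemma decseq_xseq: "decseq (\<lambda>i. xseq (Suc i))"
proof (rule decseq_SucI)
  fix i
  obtain k where k: "block_end k \<le> i" "i < block_end (Suc k)" by (rule block_cases)
  consider "k = 0" | "k \<ge> 1" "Suc i < block_end (Suc k)" | "k \<ge> 1" "Suc i = block_end (Suc k)"
    using k by linarith
  then show "xseq (Suc (Suc i)) \<le> xseq (Suc i)"
  proof cases
    case 1
    then have "xseq (Suc i) = 1" using k by (simp add: xseq_1)
    then show ?thesis using xseq_le_yseq[of "Suc i"] yseq_le_1[of "Suc (Suc i)"] by simp
  next
    case 2
    define j where "j = i - block_end k"
    have i: "i = block_end k + j" "Suc j < block_len k"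
      using 2 k by (auto simp: j_def block_end_add_len)
    have "1 / (2::real) ^ (block_len k + Suc (Suc j)) \<le> 1 / 2 ^ (block_len k + Suc j)"
      by (intro divide_left_mono power_increasing) auto
    then show ?thesis using xseq_in_block[OF 2(1), of j] xseq_in_block[OF 2(1), of "Suc j"] i by simp
  next
    case 3
    have "xseq (Suc (Suc i)) \<le> 9 / real (block_len (Suc k))"
      using 3 block_end_less[of "Suc k"] by (intro xseq_bounds(2)) simp_all
    also have "\<dots> \<le> 9 / real (2 * block_len k)"
      using block_len_grows[OF 3(1)] block_len_pos[of k] by (intro frac_le) auto
    also have "\<dots> \<le> 8 / real (block_len k)" using block_len_pos[of k] by (simp add: field_simps)
    also have "\<dots> \<le> xseq (Suc i)" by (rule xseq_bounds(1)[OF 3(1) k])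
    finally show ?thesis .
  qed
qed

section \<open>A thin set that carries the divergence of y\<close>

lemma not_summable_on_if_disjoint_blocks:
  fixes f :: "'a \<Rightarrow> real" and B :: "nat \<Rightarrow> 'a set"
  assumes nonneg: "\<And>i. i \<in> A \<Longrightarrow> f i \<ge> 0"
    and B: "\<And>k. finite (B k)" "\<And>k. B k \<subseteq> A" "disjoint_family B"
    and large: "\<And>k. sum f (B k) \<ge> 1"
  shows "\<not> f summable_on A"
proof
  assume summable: "f summable_on A"
  have "real n \<le> infsum f A" for n
  proof -
    have "real n \<le> (\<Sum>k<n. sum f (B k))"
      using sum_mono[of "{..<n}" "\<lambda>_. 1" "\<lambda>k. sum f (B k)"] large by simp
    also have "\<dots> = sum f (\<Union>k<n. B k)"
      using B by (intro sum.UNION_disjoint[symmetric]) (auto simp: disjoint_family_on_def)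
    also have "\<dots> \<le> infsum f A"
      using B nonneg by (intro finite_sum_le_infsum[OF summable]) auto
    finally show ?thesis .
  qed
  then show False using reals_Archimedean2[of "infsum f A"] by (meson not_le)
qed

lemma card_parity: "card {i \<in> {a..<a + 2 * m}. even i = s} = m"
proof (induction m)
  case (Suc m)
  have "{i \<in> {a..<a + 2 * Suc m}. even i = s} =
      insert (if even (a + 2 * m) = s then a + 2 * m else Suc (a + 2 * m)) {i \<in> {a..<a + 2 * m}. even i = s}"
    by (auto simp: less_Suc_eq)
  then show ?case using Suc.IH by simp
qed simp

text \<open>
  The first \<open>2\<^sup>k\<close> positive and \<open>2\<^sup>k\<close> negative terms of block \<open>k\<close>: just enough for \<open>y = 1 / 2\<^sup>k\<close> to contribute
  \<open>1\<close> for either sign, and few enough, among the \<open>4\<^sup>k\<^sup>+\<^sup>3\<close> or more terms with \<open>x\<close> at most \<open>9 / 4\<^sup>k\<^sup>+\<^sup>3\<close>,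
  for the sum of \<open>x\<close> to be finite.
\<close>

definition thin_block :: "nat \<Rightarrow> nat set" where
  "thin_block k = {block_end k..<block_end k + 2 * 2 ^ k}"

definition thin :: "nat set" where
  "thin = (\<Union>k\<in>{1..}. thin_block k)"

lemma thin_block_fits:
  assumes "k \<ge> 1"
  shows "4 * (2 * 2 ^ k) \<le> block_len k"
proof -
  have "(2::real) ^ k \<le> 4 ^ k" by (rule power_mono) auto
  moreover have "(4::real) ^ (k + 3) = 64 * 4 ^ k" by (simp add: power_add)
  moreover have "(0::real) \<le> 4 ^ k" by simp
  ultimately have "8 * (2::real) ^ k \<le> 4 ^ (k + 3)" by linarith
  then have "8 * (2::real) ^ k \<le> real (block_len k)" using block_len_ge[OF assms] by linarith
  then have "real (8 * 2 ^ k) \<le> real (block_len k)" by simp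
  then show ?thesis by (simp only: of_nat_le_iff)
qed

lemma thin_block_subset: "k \<ge> 1 \<Longrightarrow> thin_block k \<subseteq> {block_end k..<block_end (Suc k)}"
  using thin_block_fits[of k] by (auto simp: thin_block_def block_end_add_len)

lemma block_unique:
  assumes "i \<in> {block_end j..<block_end (Suc j)}" "i \<in> {block_end k..<block_end (Suc k)}"
  shows "j = k"
  using block_of_Suc[of j i] block_of_Suc[of k i] assms by simp

lemma mem_thin_iff:
  assumes "k \<ge> 1" "i \<in> {block_end k..<block_end (Suc k)}"
  shows "i \<in> thin \<longleftrightarrow> i \<in> thin_block k"
proof
  assume "i \<in> thin"
  then obtain j where j: "j \<ge> 1" "i \<in> thin_block j" by (auto simp: thin_def)
  then have "j = k" using thin_block_subset[of j] assms(2) by (intro block_unique[of i]) auto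
  then show "i \<in> thin_block k" using j by simp
qed (use assms in \<open>auto simp: thin_def\<close>)

lemma disjoint_family_blocks:
  assumes "\<And>k. B k \<subseteq> {block_end (Suc k)..<block_end (Suc (Suc k))}"
  shows "disjoint_family B"
proof (unfold disjoint_family_on_def, intro ballI impI)
  fix j k :: nat assume "j \<noteq> k"
  show "B j \<inter> B k = {}"
  proof (rule equals0I)
    fix i assume "i \<in> B j \<inter> B k"
    then have "Suc j = Suc k" using assms[of j] assms[of k] by (intro block_unique[of i]) auto
    then show False using \<open>j \<noteq> k\<close> by simp
  qed
qed

lemma yseq_diverges_on_thin: "\<not> (\<lambda>i. yseq (Suc i)) summable_on {i \<in> thin. odd i = s}"
proof (rule not_summable_on_if_disjoint_blocks[where B = "\<lambda>k. {i \<in> thin_block (Suc k). odd i = s}"])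
  show "disjoint_family (\<lambda>k. {i \<in> thin_block (Suc k). odd i = s})"
    using thin_block_subset by (intro disjoint_family_blocks) fastforce
  fix k
  have "{i \<in> thin_block (Suc k). odd i = s} = {i \<in> thin_block (Suc k). even i = (\<not> s)}" by auto
  then have "card {i \<in> thin_block (Suc k). odd i = s} = 2 ^ Suc k"
    unfolding thin_block_def by (simp only: card_parity)
  moreover have "(\<Sum>i\<in>{i \<in> thin_block (Suc k). odd i = s}. yseq (Suc i)) =
      (\<Sum>i\<in>{i \<in> thin_block (Suc k). odd i = s}. 1 / 2 ^ Suc k)"
    using thin_block_subset[of "Suc k"] by (intro sum.cong yseq_Suc) auto
  ultimately show "(\<Sum>i\<in>{i \<in> thin_block (Suc k). odd i = s}. yseq (Suc i)) \<ge> 1" by simp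
qed (auto simp: thin_def thin_block_def intro: less_imp_le[OF yseq_pos])

text \<open>
  At most a quarter of a block is thin, so at least a quarter of its \<open>L\<close> terms are not thin and of the
  given sign. As \<open>x \<ge> 8 / L\<close> there, they contribute at least \<open>2\<close>.
\<close>

lemma xseq_diverges_off_thin: "\<not> (\<lambda>i. xseq (Suc i)) summable_on {i \<in> - thin. odd i = s}"
proof -
  define B where "B k = {i \<in> {block_end k + 2 * 2 ^ k..<block_end (Suc k)}. odd i = s}" for k
  have B: "B k \<subseteq> {i \<in> - thin. odd i = s}" "B k \<subseteq> {block_end k..<block_end (Suc k)}" if "k \<ge> 1" for k
    using mem_thin_iff[OF that] by (auto simp: B_def thin_block_def)
  have large: "sum (\<lambda>i. xseq (Suc i)) (B k) \<ge> 1" if k: "k \<ge> 1" for k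
  proof -
    obtain n where n: "block_len k = 2 ^ n" using block_len_eq_power[OF k] by blast
    have fits: "4 * (2 * 2 ^ k) \<le> block_len k" by (rule thin_block_fits[OF k])
    have "n \<noteq> 0" 
    proof
      assume "n = 0"
      then have "block_len k = 1" using n by simp
      moreover have "(1::nat) \<le> 2 ^ k" by simp
      ultimately show False using fits by linarith
    qed
    then obtain h where h: "block_len k = 2 * h" using n by (cases n) auto
    have "block_end (Suc k) = block_end k + 2 * 2 ^ k + 2 * (h - 2 ^ k)"
      using fits h by (simp add: block_end_add_len)
    then have "B k = {i \<in> {block_end k + 2 * 2 ^ k..<block_end k + 2 * 2 ^ k + 2 * (h - 2 ^ k)}. even i = (\<not> s)}"
      unfolding B_def by auto
    then have card: "card (B k) = h - 2 ^ k" by (simp only: card_parity)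
    have "block_len k \<le> 4 * (h - 2 ^ k)" using fits h by simp
    then have "real (block_len k) \<le> 4 * real (card (B k))" unfolding card by linarith
    then have "1 \<le> real (card (B k)) * (8 / real (block_len k))"
      using block_len_pos[of k] by (simp add: field_simps)
    also have "\<dots> \<le> sum (\<lambda>i. xseq (Suc i)) (B k)"
      using B(2)[OF k] by (intro sum_bounded_below xseq_bounds(1)[OF k]) auto
    finally show ?thesis .
  qed
  show ?thesis
  proof (rule not_summable_on_if_disjoint_blocks[where B = "\<lambda>k. B (Suc k)"])
    show "disjoint_family (\<lambda>k. B (Suc k))" using B by (intro disjoint_family_blocks) auto
    show "1 \<le> sum (\<lambda>i. xseq (Suc i)) (B (Suc k))" for k using large by simp
    show "B (Suc k) \<subseteq> {i \<in> - thin. odd i = s}" for k using B by simp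
  qed (auto simp: B_def intro: less_imp_le[OF xseq_pos])
qed

lemma xseq_summable_on_thin: "(\<lambda>i. xseq (Suc i)) summable_on thin"
proof (rule nonneg_bdd_above_summable_on)
  show "bdd_above (sum (\<lambda>i. xseq (Suc i)) ` {F. F \<subseteq> thin \<and> finite F})"
  proof (rule bdd_aboveI2)
    fix F assume "F \<in> {F. F \<subseteq> thin \<and> finite F}"
    then have F: "F \<subseteq> thin" "finite F" by auto
    define K where "K = (\<lambda>i. block_of (Suc i)) ` F"
    have K: "finite K" using F by (simp add: K_def)
    have sub: "F \<subseteq> (\<Union>k\<in>K \<inter> {1..}. thin_block k)"
    proof
      fix i assume i: "i \<in> F"
      then obtain k where k: "k \<ge> 1" "i \<in> thin_block k" using F by (auto simp: thin_def)
      then have "block_of (Suc i) = k" using thin_block_subset[of k] by (intro block_of_Suc) auto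
      then show "i \<in> (\<Union>k\<in>K \<inter> {1..}. thin_block k)" using i k by (auto simp: K_def)
    qed
    have block: "(\<Sum>i\<in>thin_block k. xseq (Suc i)) \<le> (1 / 2) ^ k" if "k \<ge> 1" for k
    proof -
      have "(\<Sum>i\<in>thin_block k. xseq (Suc i)) \<le> real (card (thin_block k)) * (9 / real (block_len k))"
        using thin_block_subset[OF that] by (intro sum_bounded_above xseq_bounds(2)[OF that]) auto
      also have "\<dots> = 18 * 2 ^ k / real (block_len k)" by (simp add: thin_block_def)
      also have "\<dots> \<le> 18 * 2 ^ k / 4 ^ (k + 3)" using block_len_ge[OF that] by (intro frac_le) auto
      also have "\<dots> \<le> (1 / 2) ^ k"
      proof -
        have "(4::real) ^ k = 2 ^ k * 2 ^ k" by (simp flip: power_mult_distrib)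
        then show ?thesis by (simp add: power_add power_one_over field_simps)
      qed
      finally show ?thesis .
    qed
    have "(\<Sum>i\<in>F. xseq (Suc i)) \<le> (\<Sum>i\<in>(\<Union>k\<in>K \<inter> {1..}. thin_block k). xseq (Suc i))"
      using sub K xseq_pos by (intro sum_mono2) (auto simp: thin_block_def less_imp_le)
    also have "\<dots> = (\<Sum>k\<in>K \<inter> {1..}. \<Sum>i\<in>thin_block k. xseq (Suc i))"
    proof (rule sum.UNION_disjoint)
      show "\<forall>j\<in>K \<inter> {1..}. \<forall>k\<in>K \<inter> {1..}. j \<noteq> k \<longrightarrow> thin_block j \<inter> thin_block k = {}"
      proof (intro ballI impI equals0I)
        fix j k i assume jk: "j \<in> K \<inter> {1..}" "k \<in> K \<inter> {1..}" "j \<noteq> k" "i \<in> thin_block j \<inter> thin_block k"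
        then have "j = k"
          using thin_block_subset[of j] thin_block_subset[of k] by (intro block_unique[of i]) auto
        then show False using jk by simp
      qed
    qed (use K in \<open>auto simp: thin_block_def\<close>)
    also have "\<dots> \<le> (\<Sum>k\<in>K \<inter> {1..}. (1 / 2) ^ k)" using block by (intro sum_mono) auto
    also have "\<dots> \<le> (\<Sum>k. (1 / 2) ^ k)" using K by (intro sum_le_suminf summable_geometric) auto
    also have "\<dots> = 2" using suminf_geometric[of "1 / 2 :: real"] by simp
    finally show "(\<Sum>i\<in>F. xseq (Suc i)) \<le> 2" .
  qed
qed (simp add: less_imp_le[OF xseq_pos])

section \<open>Signed sums that vanish\<close>

lemma sum_lessThan_add:
  fixes f :: "nat \<Rightarrow> 'a::comm_monoid_add"
  shows "sum f {..<m + n} = sum f {..<m} + (\<Sum>j<n. f (m + j))"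
  by (induction n) (simp_all add: add.assoc)

text \<open>
  The length is a power of \<open>2\<close>. This is what makes all the \<open>x\<close> of a block integer multiples of the next
  \<open>\<delta>\<close>, which is \<open>1 / 4\<^sup>L\<close>.
\<close>

lemma inverse_block_len:
  assumes "k \<ge> 1"
  obtains q :: int where "1 / real (block_len k) = of_int q / 4 ^ block_len k"
proof -
  obtain n where n: "block_len k = 2 ^ n" using block_len_eq_power[OF assms] by blast
  have "n < 2 ^ n" by (rule less_exp)
  then have "n \<le> 2 * block_len k" unfolding n by linarith
  then have "(2::real) ^ (2 * block_len k - n) * 2 ^ n = 2 ^ (2 * block_len k)"
    by (simp flip: power_add)
  also have "\<dots> = 4 ^ block_len k" by (simp add: power_mult)
  finally have "1 / real (block_len k) = of_int (2 ^ (2 * block_len k - n)) / 4 ^ block_len k"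
    by (simp add: n field_simps)
  then show thesis by (rule that)
qed

lemma one_over_power_block_len: "1 / 2 ^ block_len k < 1 / real (block_len k)"
  using block_len_pos[of k] of_nat_less_two_power[of "block_len k", where 'a = real]
  by (intro divide_strict_left_mono) auto

lemma delta_eq: "k \<ge> 1 \<Longrightarrow> delta k = 4 ^ (k + 3) / block_len k"
  using delta_block_len[of k] block_len_pos[of k] by (simp add: field_simps)

lemma delta_decreasing:
  assumes "k \<ge> 1"
  shows "delta (Suc k) \<le> delta k"
proof -
  have "delta (Suc k) \<le> 1 / 2 ^ block_len k"
    unfolding delta_Suc_eq[OF assms] by (intro frac_le power_mono) auto
  also have "\<dots> \<le> 1 / real (block_len k)" using one_over_power_block_len[of k] by simp
  also have "\<dots> \<le> delta k" unfolding delta_eq[OF assms] by (intro divide_right_mono) auto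
  finally show ?thesis .
qed

text \<open>
  The difference of two choices of coefficients in \<open>{0, 1}\<close> has coefficients in \<open>{-1, 0, 1}\<close>. The
  alternating signs of the series are absorbed into \<open>\<zeta>\<close>, so that the positive \<open>x\<close> and \<open>y\<close> can be used.
\<close>

locale signed_series =
  fixes \<zeta> :: "nat \<Rightarrow> int"
  assumes \<zeta>: "\<zeta> i \<in> {-1, 0, 1}"
begin

text \<open>
  A block contributes \<open>8 S / L + T / 4\<^sup>L\<close> to the sum of \<open>x\<close>, where \<open>S\<close> is its sum of signs and \<open>T\<close> is a
  signed binary number, which vanishes only if all its digits do. \<open>P\<close> are the partial sums at the ends of the blocks.
\<close>

definition P :: "nat \<Rightarrow> real" where "P k = (\<Sum>i<block_end k. of_int (\<zeta> i) * xseq (Suc i))"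

definition S :: "nat \<Rightarrow> int" where "S k = (\<Sum>j<block_len k. \<zeta> (block_end k + j))"

definition T :: "nat \<Rightarrow> int" where
  "T k = (\<Sum>j<block_len k. \<zeta> (block_end k + j) * 2 ^ (block_len k - Suc j))"

lemma P_Suc:
  assumes "k \<ge> 1"
  shows "P (Suc k) = P k + of_int (S k) * (8 / block_len k) + of_int (T k) / 4 ^ block_len k"
proof -
  have "(\<Sum>j<block_len k. of_int (\<zeta> (block_end k + j)) * xseq (Suc (block_end k + j))) =
    (\<Sum>j<block_len k. of_int (\<zeta> (block_end k + j)) * (8 / block_len k) +
       of_int (\<zeta> (block_end k + j) * 2 ^ (block_len k - Suc j)) / 4 ^ block_len k)"
  proof (rule sum.cong)
    fix j assume "j \<in> {..<block_len k}"
    then have j: "j < block_len k" by simp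
    have "block_len k - Suc j + (block_len k + Suc j) = 2 * block_len k" using j by simp
    then have "(2::real) ^ (block_len k - Suc j) * 2 ^ (block_len k + Suc j) = 2 ^ (2 * block_len k)"
      by (simp only: power_add[symmetric])
    also have "\<dots> = 4 ^ block_len k" by (simp add: power_mult)
    finally have "1 / 2 ^ (block_len k + Suc j) = (2 ^ (block_len k - Suc j) / 4 ^ block_len k :: real)"
      by (simp add: field_simps)
    then show "of_int (\<zeta> (block_end k + j)) * xseq (Suc (block_end k + j)) =
      of_int (\<zeta> (block_end k + j)) * (8 / block_len k) +
       of_int (\<zeta> (block_end k + j) * 2 ^ (block_len k - Suc j)) / 4 ^ block_len k"
      unfolding xseq_in_block[OF assms j] by (simp add: distrib_left)
  qed simp
  then show ?thesis
    unfolding P_def block_end_add_len sum_lessThan_add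
    by (simp add: S_def T_def sum.distrib sum_distrib_right sum_divide_distrib)
qed

lemma abs_T: "\<bar>of_int (T k)\<bar> < (2 ^ block_len k :: real)"
proof -
  have "\<bar>T k\<bar> \<le> (\<Sum>j<block_len k. \<bar>\<zeta> (block_end k + j) * 2 ^ (block_len k - Suc j)\<bar>)"
    unfolding T_def by (rule sum_abs)
  also have "\<dots> \<le> (\<Sum>j<block_len k. 2 ^ (block_len k - Suc j))"
  proof (rule sum_mono)
    fix j
    show "\<bar>\<zeta> (block_end k + j) * 2 ^ (block_len k - Suc j)\<bar> \<le> 2 ^ (block_len k - Suc j)"
      using \<zeta>[of "block_end k + j"] by (auto simp: abs_mult)
  qed
  also have "\<dots> = (\<Sum>j<block_len k. 2 ^ j)" by (rule sum.nat_diff_reindex)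
  also have "\<dots> < 2 ^ block_len k" using power_diff_1_eq[of "2::int" "block_len k"] by simp
  finally have "real_of_int \<bar>T k\<bar> < of_int (2 ^ block_len k)" by (simp only: of_int_less_iff)
  then show ?thesis by simp
qed

lemma abs_T_frac: "\<bar>of_int (T k) / 4 ^ block_len k\<bar> < 1 / real (block_len k)"
proof -
  have "(4::real) ^ block_len k = 2 ^ block_len k * 2 ^ block_len k"
    by (simp flip: power_mult_distrib)
  then have "\<bar>of_int (T k) / 4 ^ block_len k\<bar> < 1 / (2 ^ block_len k :: real)"
    using abs_T[of k] by (simp add: field_simps)
  then show ?thesis using one_over_power_block_len[of k] by linarith
qed

lemma T_eq_0D:
  assumes "T k = 0" "j < block_len k"
  shows "\<zeta> (block_end k + j) = 0"
proof -
  have "(\<Sum>i=1..block_len k. \<zeta> (block_end k + (i - 1)) * 2 ^ (block_len k - i)) = 0"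
    using assms(1) by (simp add: T_def sum.atLeast1_atMost_eq)
  then have "\<forall>i\<in>{1..block_len k}. \<zeta> (block_end k + (i - 1)) = 0"
    using \<zeta> by (intro signed_binary_eq_0) auto
  then show ?thesis using assms(2) by (auto dest!: bspec[of _ _ "Suc j"])
qed

lemma P_1: "P 1 = of_int (\<zeta> 0)"
  by (simp add: P_def xseq_1)

lemma P_multiple_of_delta:
  assumes "k \<ge> 1"
  shows "\<exists>z :: int. P k = of_int z * delta k"
  using assms
proof (induction k rule: nat_induct_at_least)
  case base
  show ?case using P_1 construction_base(4) by auto
next
  case (Suc k)
  then obtain z :: int where z: "P k = of_int z * delta k" by blast
  obtain q :: int where q: "1 / real (block_len k) = of_int q / 4 ^ block_len k"
    using Suc.hyps by (rule inverse_block_len)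
  have "P (Suc k) = (of_int z * 4 ^ (k + 3) + of_int (S k) * 8) * (1 / real (block_len k)) +
      of_int (T k) / 4 ^ block_len k"
    unfolding P_Suc[OF Suc.hyps] z delta_eq[OF Suc.hyps] by (simp add: algebra_simps)
  also have "\<dots> = of_int ((z * 4 ^ (k + 3) + S k * 8) * q + T k) * delta (Suc k)"
    unfolding q delta_Suc_eq[OF Suc.hyps] by (simp add: add_divide_distrib)
  finally show ?case by blast
qed

text \<open>
  The sum before block \<open>k\<close> is a multiple of \<open>\<delta>\<^sub>k\<close>, hence of \<open>1 / L\<close>, and so is the part with \<open>S\<close>; the part
  with \<open>T\<close> is smaller than \<open>1 / L\<close>. In a vanishing sum both parts vanish, and \<open>T = 0\<close> forces all digits to
  be \<open>0\<close>.
\<close>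

lemma P_Suc_eq_0D:
  assumes k: "k \<ge> 1" and P0: "P (Suc k) = 0"
  shows "P k = 0" "\<And>j. j < block_len k \<Longrightarrow> \<zeta> (block_end k + j) = 0"
proof -
  obtain z :: int where z: "P k = of_int z * delta k" using P_multiple_of_delta[OF k] by blast
  define U where "U = z * 4 ^ (k + 3) + S k * 8"
  have eq: "of_int U / real (block_len k) + of_int (T k) / 4 ^ block_len k = 0"
    using P0 unfolding P_Suc[OF k] z delta_eq[OF k] U_def by (simp add: algebra_simps add_divide_distrib)
  have "U = 0"
  proof (rule ccontr)
    assume "U \<noteq> 0"
    then have "1 \<le> \<bar>real_of_int U\<bar>" by linarith
    then have "1 / real (block_len k) \<le> \<bar>of_int U / real (block_len k)\<bar>"
      by (simp add: divide_right_mono)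
    then show False using eq abs_T_frac[of k] by linarith
  qed
  then have "T k = 0" using eq by simp
  then show zero: "\<zeta> (block_end k + j) = 0" if "j < block_len k" for j using T_eq_0D that by blast
  then have "S k = 0" by (simp add: S_def)
  then show "P k = 0" using P0 \<open>T k = 0\<close> P_Suc[OF k] by simp
qed

text \<open>
  As \<open>1 / L = \<delta>\<^sub>k / 4\<^sup>k\<^sup>+\<^sup>3\<close>, a block with at most \<open>2\<^sup>k\<close> surplus signs moves the sum by a small fraction
  of \<open>\<delta>\<^sub>k\<close> only.
\<close>

lemma P_step_le:
  assumes k: "k \<ge> 1" and S: "\<bar>of_int (S k)\<bar> \<le> (2 ^ k :: real)"
  shows "\<bar>P (Suc k) - P k\<bar> \<le> delta k / (4 * 2 ^ k)"
proof -
  have four: "(4::real) ^ (k + 3) = 64 * (2 ^ k * 2 ^ k)"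
    by (simp add: power_add flip: power_mult_distrib)
  have inv: "1 / real (block_len k) = delta k / 4 ^ (k + 3)" by (simp add: delta_eq[OF k])
  have "\<bar>of_int (S k) * (8 / block_len k)\<bar> \<le> 2 ^ k * (8 * (1 / real (block_len k)))"
    unfolding abs_mult using S by (intro mult_mono) auto
  also have "\<dots> = delta k / (8 * 2 ^ k)" unfolding inv four by (simp add: field_simps)
  finally have 1: "\<bar>of_int (S k) * (8 / block_len k)\<bar> \<le> delta k / (8 * 2 ^ k)" .
  have "(1::real) \<le> 2 ^ k" by simp
  then have "8 * 2 ^ k \<le> 64 * (2 ^ k * 2 ^ k :: real)" by (intro mult_mono) auto
  then have "1 / real (block_len k) \<le> delta k / (8 * 2 ^ k)"
    unfolding inv four using delta_pos[of k] by (intro divide_left_mono) auto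
  then have "\<bar>P (Suc k) - P k\<bar> \<le> delta k / (8 * 2 ^ k) + delta k / (8 * 2 ^ k)"
    using 1 abs_T_frac[of k] unfolding P_Suc[OF k] by linarith
  also have "\<dots> = delta k / (4 * 2 ^ k)" by (simp add: field_simps)
  finally show ?thesis .
qed

lemma P_tail_le:
  assumes K: "K \<ge> 1" and S: "\<And>k. k \<ge> K \<Longrightarrow> \<bar>of_int (S k)\<bar> \<le> (2 ^ k :: real)" and "j \<ge> K"
  shows "\<bar>P j - P K\<bar> \<le> delta K / 2"
proof -
  \<comment> \<open>The last term leaves room for the steps still to come, which add up geometrically.\<close>
  have "delta j \<le> delta K \<and> \<bar>P j - P K\<bar> \<le> delta K * (1 / 2 - 1 / (2 * 2 ^ j))"
    using \<open>j \<ge> K\<close>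
  proof (induction j rule: dec_induct)
    case base
    have "1 / (2 * 2 ^ K) \<le> (1 / 2 :: real)" by (simp add: field_simps)
    then show ?case using delta_pos[of K] by simp
  next
    case (step j)
    have j: "j \<ge> 1" using K step.hyps by simp
    have "\<bar>P (Suc j) - P j\<bar> \<le> delta j / (4 * 2 ^ j)"
      using S step.hyps by (intro P_step_le[OF j]) simp
    also have "\<dots> \<le> delta K / (4 * 2 ^ j)" using step.IH by (intro divide_right_mono) auto
    finally have "\<bar>P (Suc j) - P K\<bar> \<le> delta K * (1 / 2 - 1 / (2 * 2 ^ j)) + delta K / (4 * 2 ^ j)"
      using step.IH by linarith
    also have "\<dots> = delta K * (1 / 2 - 1 / (2 * 2 ^ Suc j))" by (simp add: field_simps)
    finally show ?case using step.IH delta_decreasing[OF j] by simp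
  qed
  moreover have "delta K * (1 / 2 - 1 / (2 * 2 ^ j)) \<le> delta K * (1 / 2)"
    using delta_pos[of K] by (intro mult_left_mono) auto
  ultimately show ?thesis by linarith
qed

lemma strict_mono_block_end: "strict_mono block_end"
  using block_end_less by (rule strict_mono_Suc_iff[THEN iffD2, OF allI])

text \<open>
  The only use of the convergence in the second coordinate: block \<open>k\<close> contributes \<open>S / 2\<^sup>k\<close> to it.
\<close>

lemma S_eventually_small:
  assumes "summable (\<lambda>i. of_int (\<zeta> i) * yseq (Suc i))"
  shows "\<forall>\<^sub>F k in sequentially. \<bar>of_int (S k)\<bar> \<le> (2 ^ k :: real)"
proof -
  define Q where "Q k = (\<Sum>i<block_end k. of_int (\<zeta> i) * yseq (Suc i))" for k
  obtain l where "(\<lambda>n. \<Sum>i<n. of_int (\<zeta> i) * yseq (Suc i)) \<longlonglongrightarrow> l"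
    using assms unfolding summable_def sums_def by blast
  from LIMSEQ_subseq_LIMSEQ[OF this strict_mono_block_end] have Q: "Q \<longlonglongrightarrow> l"
    by (simp add: Q_def[abs_def] o_def)
  have "(\<lambda>k. Q (Suc k) - Q k) \<longlonglongrightarrow> 0" using tendsto_diff[OF LIMSEQ_Suc[OF Q] Q] by simp
  moreover have "Q (Suc k) - Q k = of_int (S k) / 2 ^ k" for k
  proof -
    have "(\<Sum>j<block_len k. of_int (\<zeta> (block_end k + j)) * yseq (Suc (block_end k + j))) =
      (\<Sum>j<block_len k. of_int (\<zeta> (block_end k + j)) * (1 / 2 ^ k))"
      by (intro sum.cong) (auto simp: block_end_add_len yseq_Suc[of k])
    then show ?thesis
      unfolding Q_def block_end_add_len sum_lessThan_add by (simp add: S_def sum_divide_distrib)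
  qed
  ultimately have "(\<lambda>k. of_int (S k) / 2 ^ k :: real) \<longlonglongrightarrow> 0" by simp
  then have "\<forall>\<^sub>F k in sequentially. norm (of_int (S k) / 2 ^ k :: real) < 1"
    by (intro order_tendstoD(2)[OF tendsto_norm_zero]) auto
  then show ?thesis by eventually_elim (simp add: divide_simps)
qed

text \<open>
  For large \<open>K\<close> the sum \<open>P K\<close> is a multiple of \<open>\<delta>\<^sub>K\<close> and differs from the total sum \<open>0\<close> by at most
  \<open>\<delta>\<^sub>K / 2\<close>, so it vanishes. Going backwards from there, every block vanishes.
\<close>

lemma eq_0_if_sums_0:
  assumes x: "(\<lambda>i. of_int (\<zeta> i) * xseq (Suc i)) sums 0"
    and y: "summable (\<lambda>i. of_int (\<zeta> i) * yseq (Suc i))"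
  shows "\<zeta> i = 0"
proof -
  obtain K0 where K0: "\<And>k. k \<ge> K0 \<Longrightarrow> \<bar>of_int (S k)\<bar> \<le> (2 ^ k :: real)"
    using S_eventually_small[OF y] by (auto simp: eventually_sequentially)
  have P_lim: "P \<longlonglongrightarrow> 0"
    using LIMSEQ_subseq_LIMSEQ[OF x[unfolded sums_def] strict_mono_block_end]
    by (simp add: P_def[abs_def] o_def)
  have P_ge: "P K = 0" if K: "K \<ge> max 1 K0" for K
  proof -
    have K1: "K \<ge> 1" using K by simp
    have "(\<lambda>j. \<bar>P j - P K\<bar>) \<longlonglongrightarrow> \<bar>0 - P K\<bar>" by (intro tendsto_intros P_lim)
    moreover have "\<bar>P j - P K\<bar> \<le> delta K / 2" if "j \<ge> K" for j
      using K1 K0 K that by (intro P_tail_le) auto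
    ultimately have le: "\<bar>0 - P K\<bar> \<le> delta K / 2" by (intro LIMSEQ_le_const2) auto
    obtain z :: int where z: "P K = of_int z * delta K" using P_multiple_of_delta[OF K1] by blast
    have "\<bar>of_int z\<bar> * delta K \<le> 1 / 2 * delta K"
      using le delta_pos[of K] by (simp add: z abs_mult)
    then have "\<bar>of_int z\<bar> \<le> (1 / 2 :: real)" using delta_pos[of K] by (simp only: mult_le_cancel_right_pos)
    then have "z = 0" by linarith
    then show ?thesis by (simp add: z)
  qed
  have P_0: "P k = 0" if k: "k \<ge> 1" for k
  proof (cases "k \<ge> max 1 K0")
    case False
    then have "k \<le> max 1 K0" by linarith
    then show ?thesis
    proof (induction rule: inc_induct)
      case (step j)
      have "j \<ge> 1" using k step.hyps by linarith
      then show ?case using step.IH by (rule P_Suc_eq_0D(1))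
    qed (simp add: P_ge)
  qed (rule P_ge)
  obtain k where k: "block_end k \<le> i" "i < block_end (Suc k)" by (rule block_cases)
  show ?thesis
  proof (cases "k \<ge> 1")
    case True
    then show ?thesis using P_Suc_eq_0D(2)[OF True P_0, of "i - block_end k"] k
      by (simp add: block_end_add_len)
  next
    case False
    then have "i = 0" using k by (simp add: not_le)
    then show ?thesis using P_1 P_0[of 1] by simp
  qed
qed

end

section \<open>The series in the plane\<close>

definition vseq :: "nat \<Rightarrow> real \<times> real" where
  "vseq i = ((-1) ^ Suc i * xseq (Suc i), (-1) ^ Suc i * yseq (Suc i))"

lemma norm_vseq_ge: "yseq (Suc i) \<le> norm (vseq i)"
  unfolding vseq_def by (rule order_trans[OF _ norm_snd_le]) (simp add: abs_mult)

lemma norm_vseq_le: "norm (vseq i) \<le> xseq (Suc i) + yseq (Suc i)"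
  unfolding vseq_def using xseq_pos[of "Suc i"] yseq_pos[of "Suc i"]
  by (intro order_trans[OF norm_Pair_le]) (simp add: abs_mult)

lemma conditionally_convergent_vseq: "conditionally_convergent vseq"
  unfolding conditionally_convergent_def
proof
  have alt: "summable (\<lambda>i. (-1) ^ Suc i * a i)" if "a \<longlonglongrightarrow> 0" "decseq a" for a :: "nat \<Rightarrow> real"
    using summable_minus[OF summable_Leibniz(1)[OF that(1) decseq_imp_monoseq[OF that(2)]]] by simp
  obtain a where a: "(\<lambda>i. (-1) ^ Suc i * xseq (Suc i)) sums a"
    using alt[OF xseq_tendsto decseq_xseq] unfolding summable_def by blast
  obtain b where b: "(\<lambda>i. (-1) ^ Suc i * yseq (Suc i)) sums b"
    using alt[OF yseq_tendsto decseq_yseq] unfolding summable_def by blast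
  have "vseq sums (a, b)" unfolding vseq_def[abs_def] sums_Pair_iff using a b ..
  then show "summable vseq" by (rule sums_summable)
  show "\<not> summable (\<lambda>i. norm (vseq i))"
  proof
    assume "summable (\<lambda>i. norm (vseq i))"
    then have "summable (\<lambda>i. yseq (Suc i))"
    proof (rule summable_comparison_test'[where N = 0])
      fix i
      show "norm (yseq (Suc i)) \<le> norm (vseq i)"
        using norm_vseq_ge[of i] yseq_pos[of "Suc i"] by simp
    qed
    then have "(\<lambda>i. yseq (Suc i)) summable_on UNIV"
      by (intro summable_nonneg_imp_summable_on less_imp_le[OF yseq_pos])
    then have "(\<lambda>i. yseq (Suc i)) summable_on {i \<in> thin. odd i = True}"
      by (rule summable_on_subset_banach) simp
    then show False using yseq_diverges_on_thin by blast
  qed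
qed

lemma summable_on_alternating_iff:
  fixes a :: "nat \<Rightarrow> real"
  assumes "\<And>i. a i > 0"
  shows "(\<lambda>i. (-1) ^ Suc i * a i) summable_on A \<longleftrightarrow> a summable_on A"
proof -
  have "norm ((-1) ^ Suc i * a i) = a i" for i using assms[of i] by (simp add: abs_mult)
  then show ?thesis
    unfolding summable_on_iff_abs_summable_on_real[of "\<lambda>i. (-1) ^ Suc i * a i"] by simp
qed

lemma alternating_pos_iff: "a > 0 \<Longrightarrow> (-1) ^ Suc i * a > 0 \<longleftrightarrow> odd i" for a :: real
  by (cases "even i") auto

lemma sum_range_vseq: "sum_range vseq = UNIV"
  unfolding vseq_def[abs_def]
proof (rule sum_range_plane_eq_UNIV[where M = "- thin"])
  show "(\<lambda>i. (-1) ^ Suc i * xseq (Suc i)) \<longlonglongrightarrow> 0"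
    by (rule tendsto_rabs_zero_cancel) (simp add: abs_mult tendsto_rabs_zero[OF xseq_tendsto])
  show "(\<lambda>i. (-1) ^ Suc i * yseq (Suc i)) \<longlonglongrightarrow> 0"
    by (rule tendsto_rabs_zero_cancel) (simp add: abs_mult tendsto_rabs_zero[OF yseq_tendsto])
  fix i
  show "(-1) ^ Suc i * yseq (Suc i) > 0 \<Longrightarrow> (-1) ^ Suc i * xseq (Suc i) \<ge> 0"
    using xseq_pos[of "Suc i"] by (simp only: alternating_pos_iff[OF yseq_pos]) simp
  show "\<not> (-1) ^ Suc i * yseq (Suc i) > 0 \<Longrightarrow> (-1) ^ Suc i * xseq (Suc i) \<le> 0"
    using xseq_pos[of "Suc i"] by (simp only: alternating_pos_iff[OF yseq_pos]) simp
qed (simp_all only: summable_on_alternating_iff xseq_pos yseq_pos alternating_pos_iff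
      double_complement xseq_summable_on_thin xseq_diverges_off_thin yseq_diverges_on_thin not_False_eq_True)

text \<open>
  Since \<open>x \<le> y\<^sup>2\<close>, the norm of a term is at most \<open>(1 + y) y\<close>. Once \<open>y \<le> e\<close>, the term lies in the cone
  because \<open>(1 - e) (1 + e) \<le> 1\<close>.
\<close>

lemma levy_vector_vertical:
  assumes c: "c = 1 \<or> c = -1"
  shows "levy_vector vseq (0, c)"
  unfolding levy_vector_def
proof (intro conjI allI impI)
  show norm1: "norm (0 :: real, c) = 1" using c by (auto simp: norm_Pair)
  fix e :: real assume e: "e > 0"
  let ?A = "{i. vseq i \<in> levy_cone e (0, c)}" and ?B = "{i \<in> thin. odd i = (c = 1)}"
  obtain N where N: "\<And>i. i \<ge> N \<Longrightarrow> yseq (Suc i) < e"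
    using order_tendstoD(2)[OF yseq_tendsto e] by (auto simp: eventually_sequentially)
  have sub: "?B - {..<N} \<subseteq> ?A"
  proof
    fix i assume i: "i \<in> ?B - {..<N}"
    have inner: "inner (0, c) (vseq i) = yseq (Suc i)" using i c by (auto simp: vseq_def)
    have y: "0 < yseq (Suc i)" "yseq (Suc i) < e" using N i yseq_pos by auto
    have "(1 - e) * norm (vseq i) \<le> yseq (Suc i)"
    proof (cases "e \<ge> 1")
      case True
      then have "(1 - e) * norm (vseq i) \<le> 0" by (intro mult_nonpos_nonneg) auto
      then show ?thesis using y by simp
    next
      case False
      have "norm (vseq i) \<le> (1 + yseq (Suc i)) * yseq (Suc i)"
        using norm_vseq_le[of i] xseq_le_yseq_sq[of i] by (simp add: algebra_simps power2_eq_square)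
      also have "\<dots> \<le> (1 + e) * yseq (Suc i)" using y by (intro mult_right_mono) auto
      finally have "(1 - e) * norm (vseq i) \<le> (1 - e) * ((1 + e) * yseq (Suc i))"
        using False by (intro mult_left_mono) auto
      also have "\<dots> = yseq (Suc i) - e * e * yseq (Suc i)" by (simp add: algebra_simps)
      also have "\<dots> \<le> yseq (Suc i)" using y by simp
      finally show ?thesis .
    qed
    then show "i \<in> ?A" by (simp only: levy_cone_def inner norm1 mem_Collect_eq mult_1_right)
  qed
  show "\<not> (\<lambda>i. norm (vseq i)) summable_on ?A"
  proof
    assume "(\<lambda>i. norm (vseq i)) summable_on ?A"
    then have "(\<lambda>i. norm (vseq i)) summable_on (?B - {..<N})"
      by (rule summable_on_subset_banach[OF _ sub])
    then have "(\<lambda>i. yseq (Suc i)) summable_on (?B - {..<N})"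
      by (rule summable_on_comparison_test) (auto simp: norm_vseq_ge less_imp_le[OF yseq_pos])
    then have "(\<lambda>i. yseq (Suc i)) summable_on (?B - {..<N}) \<union> (?B \<inter> {..<N})"
      by (rule summable_on_Un_disjoint) (auto intro!: summable_on_finite)
    also have "(?B - {..<N}) \<union> (?B \<inter> {..<N}) = ?B" by blast
    finally show False using yseq_diverges_on_thin by blast
  qed
qed

text \<open>
  If \<open>\<bar>q\<bar> < 1\<close>, then the cone of aperture \<open>e = (1 - \<bar>q\<bar>) / 2\<close> contains only terms with \<open>y \<ge> e\<close>, since the
  inner product with \<open>(p, q)\<close> is at most \<open>y\<^sup>2 + \<bar>q\<bar> y\<close>. These are finitely many.
\<close>

lemma levy_vectorD:
  assumes "levy_vector vseq (p, q)"
  shows "\<bar>q\<bar> \<ge> 1"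
proof (rule ccontr)
  assume "\<not> \<bar>q\<bar> \<ge> 1"
  then have q: "\<bar>q\<bar> < 1" by simp
  have norm1: "norm (p, q) = 1" using assms by (simp add: levy_vector_def)
  have p: "\<bar>p\<bar> \<le> 1" using norm_fst_le[of p q] norm1 by simp
  define e where "e = (1 - \<bar>q\<bar>) / 2"
  have e: "e > 0" "1 - e - \<bar>q\<bar> = e" "e \<le> 1" using q by (auto simp: e_def field_simps)
  obtain N where N: "\<And>i. i \<ge> N \<Longrightarrow> yseq (Suc i) < e"
    using order_tendstoD(2)[OF yseq_tendsto e(1)] by (auto simp: eventually_sequentially)
  have "{i. vseq i \<in> levy_cone e (p, q)} \<subseteq> {..<N}"
  proof
    fix i assume "i \<in> {i. vseq i \<in> levy_cone e (p, q)}"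
    then have cone: "(1 - e) * norm (vseq i) \<le> inner (p, q) (vseq i)"
      by (simp add: levy_cone_def norm1)
    have "(1 - e) * yseq (Suc i) \<le> (1 - e) * norm (vseq i)"
      using e norm_vseq_ge[of i] by (intro mult_left_mono) auto
    also note cone
    also have "inner (p, q) (vseq i) \<le> \<bar>p\<bar> * xseq (Suc i) + \<bar>q\<bar> * yseq (Suc i)"
    proof -
      have "inner (p, q) (vseq i) \<le> \<bar>p * ((-1) ^ Suc i * xseq (Suc i))\<bar> + \<bar>q * ((-1) ^ Suc i * yseq (Suc i))\<bar>"
        unfolding vseq_def inner_Pair inner_real_def by linarith
      then show ?thesis using xseq_pos[of "Suc i"] yseq_pos[of "Suc i"] by (simp add: abs_mult)
    qed
    also have "\<bar>p\<bar> * xseq (Suc i) \<le> 1 * (yseq (Suc i))\<^sup>2"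
      using p xseq_le_yseq_sq[of i] xseq_pos[of "Suc i"] by (intro mult_mono) auto
    finally have "(1 - e - \<bar>q\<bar>) * yseq (Suc i) \<le> yseq (Suc i) * yseq (Suc i)"
      by (simp add: algebra_simps power2_eq_square)
    then have "e \<le> yseq (Suc i)" using yseq_pos[of "Suc i"] unfolding e(2) by simp
    then show "i \<in> {..<N}" using N[of i] by (meson lessThan_iff not_le)
  qed
  then have "(\<lambda>i. norm (vseq i)) summable_on {i. vseq i \<in> levy_cone e (p, q)}"
    by (intro summable_on_finite) (rule finite_subset, auto)
  then show False using assms e(1) by (simp add: levy_vector_def)
qed

lemma levy_vectors_vseq: "{u. levy_vector vseq u} = {(0, 1), (0, -1)}"
proof (intro equalityI subsetI)
  fix u assume u: "u \<in> {u. levy_vector vseq u}"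
  obtain p q where pq: "u = (p, q)" by fastforce
  have q: "\<bar>q\<bar> \<ge> 1" using u levy_vectorD pq by simp
  have "norm (p, q) = 1" using u by (simp add: pq levy_vector_def)
  then have "p\<^sup>2 + q\<^sup>2 = 1" by (simp add: norm_Pair)
  moreover have "1\<^sup>2 \<le> \<bar>q\<bar>\<^sup>2" using q by (intro power_mono) auto
  ultimately have "p\<^sup>2 = 0 \<and> q\<^sup>2 = 1" using zero_le_power2[of p] by (simp only: power2_abs one_power2) linarith
  then show "u \<in> {(0, 1), (0, -1)}" by (auto simp: pq power2_eq_1_iff)
qed (auto intro: levy_vector_vertical)

lemma achievement_section_unique:
  assumes "(a, b) \<in> achievement_set vseq" "(a, b') \<in> achievement_set vseq"
  shows "b = b'"
proof -
  obtain \<epsilon> \<epsilon>' :: "nat \<Rightarrow> real" where \<epsilon>: "\<And>i. \<epsilon> i \<in> {0, 1}" "\<And>i. \<epsilon>' i \<in> {0, 1}"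
    and sums: "(\<lambda>i. \<epsilon> i *\<^sub>R vseq i) sums (a, b)" "(\<lambda>i. \<epsilon>' i *\<^sub>R vseq i) sums (a, b')"
    using assms unfolding achievement_set_def by blast
  define \<zeta> :: "nat \<Rightarrow> int" where "\<zeta> i = (-1) ^ Suc i * (of_bool (\<epsilon> i = 1) - of_bool (\<epsilon>' i = 1))" for i
  have of_int_\<zeta>: "of_int (\<zeta> i) = (-1) ^ Suc i * (\<epsilon> i - \<epsilon>' i)" for i
    using \<epsilon>(1)[of i] \<epsilon>(2)[of i] by (auto simp: \<zeta>_def)
  interpret signed_series \<zeta>
  proof
    fix i show "\<zeta> i \<in> {-1, 0, 1}" by (cases "even i") (auto simp: \<zeta>_def)
  qed
  have "(\<lambda>i. \<epsilon> i *\<^sub>R vseq i - \<epsilon>' i *\<^sub>R vseq i) sums ((a, b) - (a, b'))"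
    using sums by (rule sums_diff)
  moreover have "\<epsilon> i *\<^sub>R vseq i - \<epsilon>' i *\<^sub>R vseq i =
      (of_int (\<zeta> i) * xseq (Suc i), of_int (\<zeta> i) * yseq (Suc i))" for i
    by (cases "even i") (simp_all add: of_int_\<zeta> vseq_def algebra_simps)
  ultimately have xy: "(\<lambda>i. of_int (\<zeta> i) * xseq (Suc i)) sums 0"
    "(\<lambda>i. of_int (\<zeta> i) * yseq (Suc i)) sums (b - b')"
    by (simp_all add: sums_Pair_iff)
  then have "\<zeta> i = 0" for i using sums_summable by (intro eq_0_if_sums_0)
  then have "(\<lambda>i :: nat. 0) sums (b - b')" using xy(2) by simp
  then show ?thesis using sums_unique2[OF _ sums_zero] by fastforce
qed

theorem mainTheorem4:
  fixes v :: "nat \<Rightarrow> real \<times> real"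
  defines "v \<equiv> \<lambda>i. ((-1) ^ i * xseq i, (-1) ^ i * yseq i)"
  shows "conditionally_convergent (\<lambda>i. v (i + 1)) \<and>
         sum_range (\<lambda>i. v (i + 1)) = UNIV \<and>
         card {u. levy_vector (\<lambda>i. v (i + 1)) u} = 2 \<and>
         (\<forall>a. \<exists>\<^sub>\<le>\<^sub>1 b. b \<in> vertical_section (achievement_set (\<lambda>i. v (i + 1))) a)"
proof -
  have v: "(\<lambda>i. v (i + 1)) = vseq"
    by (rule ext) (simp only: v_def vseq_def Suc_eq_plus1)
  have "\<exists>\<^sub>\<le>\<^sub>1 b. b \<in> vertical_section (achievement_set vseq) a" for a
    using achievement_section_unique by (intro Uniq_I) (auto simp: vertical_section_def)
  then show ?thesis
    unfolding v levy_vectors_vseq using conditionally_convergent_vseq sum_range_vseq by simp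
qed

end
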